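(* Let $d\ge2$ and let $a_0,\dots,a_{d-1}\in\mathbb{R}$ be constants such that the polynomial $p(s)=s^d+a_{d-1}s^{d-1}+\cdots+a_1s+a_0$ is Hurwitz. Consider the differential equation with state $E\in\mathrm{GL}(n,\mathbb{R})$, $e_i\in\mathrm{M}(n,\mathbb{R})$, $i=2,\dots,d$, $$\dot E = e_2E - a_{d-1}E\log(E),\qquad \dot e_i = e_{i+1}-a_{d-i}\log(E)\ \ (2\le i\le d-1),\qquad \dot e_d = -a_0\log(E).$$ In the open neighbourhood $B(I_n,1)\times(\mathrm{M}(n,\mathbb{R}))^{d-1}$ this differential equation is differentially equivalent to $$\dot e_1 = e_2 - a_{d-1}e_1 + K(e_1,e_2),\qquad \dot e_i = e_{i+1}-a_{d-i}e_1\ \ (2\le i\le d-1),\qquad \dot e_d = -a_0e_1,$$ where $e_1:=\log(E)$ and $K:\mathrm{M}(n,\mathbb{R})\times\mathrm{M}(n,\mathbb{R})\to\mathrm{M}(n,\mathbb{R})$ is a smooth function that vanishes if $e_1$ and $e_2$ commute, i.e. $K(e_1,e_2)=0_n$ for all $e_1,e_2\in\mathrm{M}(n,\mathbb{R})$ with $[e_1,e_2]=0_n$.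
   Context: $\mathrm{M}(n,\mathbb{R})$ is the algebra of real $n\times n$ matrices with $[A,B]=AB-BA$. $\|\cdot\|$ is the matrix norm induced by the Euclidean norm, $I_n$ and $0_n$ are the $n\times n$ identity and zero matrices, and $B(A,r)=\{X\in\mathbb{R}^{n\times n}:\|A-X\|<r\}$. For a real matrix $X$ with no eigenvalue in $(-\infty,0]$, $\log(X)$ is the principal logarithm: the unique real $A$ with $\exp(A)=X$ whose eigenvalues all lie in $\{z\in\mathbb{C}:-\pi<\mathrm{Im}(z)<\pi\}$; for $X\in B(I_n,1)$ it equals $\sum_{k\ge1}\frac{(-1)^{k+1}}{k}(X-I_n)^k$, and $\log$ is a diffeomorphism of $B(I_n,1)$ onto its image. "Differentially equivalent" means that the change of coordinates $(E,e_2,\dots,e_d)\mapsto(\log(E),e_2,\dots,e_d)$ transforms the first system into the second. A polynomial is Hurwitz if all its roots have strictly negative real part. For $d=2$ the middle family of equations is empty. *)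

theory Defs
  imports "HOL-Analysis.Analysis" "HOL-Computational_Algebra.Polynomial"
begin

text \<open>
  The type \<open>real^'n^'n\<close> carries no Banach algebra structure whose product is the matrix
  product, so the exponential is written out as its power series.
\<close>

definition matrix_exp :: "real^'n^'n \<Rightarrow> real^'n^'n" where
  "matrix_exp A = (\<Sum>k. ((**) A ^^ k) (mat 1) /\<^sub>R fact k)"

definition eigenvalues :: "real^'n^'n \<Rightarrow> complex set" where
  "eigenvalues A =
    {c. \<exists>v :: complex^'n. v \<noteq> 0 \<and> map_matrix complex_of_real A *v v = c *s v}"

text \<open>
  The principal logarithm; the value is meaningful only if \<open>X\<close> has no eigenvalue in the
  closed negative real axis.
\<close>

definition principal_log :: "real^'n^'n \<Rightarrow> real^'n^'n" where
  "principal_log X =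
    (THE A. matrix_exp A = X \<and> (\<forall>c \<in> eigenvalues A. - pi < Im c \<and> Im c < pi))"

text \<open>
  \<open>norm\<close> on \<open>real^'n^'n\<close> is the Frobenius norm; the norm induced by the Euclidean norm is the
  operator norm.
\<close>

definition matrix_ball :: "real^'n^'n \<Rightarrow> real \<Rightarrow> (real^'n^'n) set" where
  "matrix_ball A r = {X. onorm ((*v) (A - X)) < r}"

definition Hurwitz :: "real poly \<Rightarrow> bool" where
  "Hurwitz p \<longleftrightarrow> (\<forall>z :: complex. poly (map_poly of_real p) z = 0 \<longrightarrow> Re z < 0)"

text \<open>\<open>Ck_on S k f\<close>: on the open set \<open>S\<close>, \<open>f\<close> is \<open>k\<close> times continuously differentiable.\<close>

primrec Ck_on ::
  "'a::euclidean_space set \<Rightarrow> nat \<Rightarrow> ('a \<Rightarrow> 'b::euclidean_space) \<Rightarrow> bool" where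
  "Ck_on S 0 f \<longleftrightarrow> continuous_on S f"
| "Ck_on S (Suc k) f \<longleftrightarrow>
     (\<forall>x\<in>S. f differentiable (at x)) \<and> (\<forall>v. Ck_on S k (\<lambda>x. frechet_derivative f (at x) v))"

definition smooth_on :: "'a::euclidean_space set \<Rightarrow> ('a \<Rightarrow> 'b::euclidean_space) \<Rightarrow> bool" where
  "smooth_on S f \<longleftrightarrow> open S \<and> (\<forall>k. Ck_on S k f)"

definition diffeomorphism_onto_image ::
  "'a::euclidean_space set \<Rightarrow> ('a \<Rightarrow> 'b::euclidean_space) \<Rightarrow> bool" where
  "diffeomorphism_onto_image U \<phi> \<longleftrightarrow>
     inj_on \<phi> U \<and> smooth_on U \<phi> \<and> smooth_on (\<phi> ` U) (inv_into U \<phi>)"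

text \<open>
  A state \<open>(x\<^sub>1, \<dots>, x\<^sub>d)\<close> is a function on \<open>nat\<close> of which only the values at \<open>1, \<dots>, d\<close> matter,
  and a right-hand side maps states to states.
\<close>

definition solves_ode ::
  "nat \<Rightarrow> ((nat \<Rightarrow> 'a) \<Rightarrow> nat \<Rightarrow> 'a) \<Rightarrow> real set \<Rightarrow> (real \<Rightarrow> nat \<Rightarrow> 'a::real_normed_vector) \<Rightarrow> bool" where
  "solves_ode d F J x \<longleftrightarrow>
     (\<forall>t\<in>J. \<forall>i\<in>{1..d}. ((\<lambda>s. x s i) has_vector_derivative F (x t) i) (at t))"

text \<open>
  The change of coordinates \<open>(x\<^sub>1, x\<^sub>2, \<dots>, x\<^sub>d) \<mapsto> (\<phi> x\<^sub>1, x\<^sub>2, \<dots>, x\<^sub>d)\<close>, with \<open>x\<^sub>1\<close> ranging over \<open>U\<close>,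
  transforms the system \<open>F\<close> into the system \<open>G\<close>. As \<open>\<phi>\<close> is injective on \<open>U\<close>, every curve with first
  component in \<open>\<phi> ` U\<close> is the transform of exactly one curve with first component in \<open>U\<close>, so the
  equivalence below is a bijection between the solutions of the two systems.
\<close>

definition differentially_equivalent ::
  "nat \<Rightarrow> 'a set \<Rightarrow> ('a \<Rightarrow> 'a) \<Rightarrow>
   ((nat \<Rightarrow> 'a) \<Rightarrow> nat \<Rightarrow> 'a) \<Rightarrow> ((nat \<Rightarrow> 'a) \<Rightarrow> nat \<Rightarrow> 'a::euclidean_space) \<Rightarrow> bool" where
  "differentially_equivalent d U \<phi> F G \<longleftrightarrow>
     diffeomorphism_onto_image U \<phi> \<and>
     (\<forall>J x. open J \<and> is_interval J \<and> (\<forall>t\<in>J. x t 1 \<in> U) \<longrightarrow>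
        (solves_ode d F J x \<longleftrightarrow> solves_ode d G J (\<lambda>t. (x t)(1 := \<phi> (x t 1)))))"

text \<open>The first component of the state is \<open>E\<close> here, and \<open>e\<^sub>1 = log E\<close> in the second system.\<close>

definition group_system ::
  "nat \<Rightarrow> (nat \<Rightarrow> real) \<Rightarrow> (nat \<Rightarrow> real^'n^'n) \<Rightarrow> nat \<Rightarrow> real^'n^'n" where
  "group_system d a x i =
     (if i = 1 then x 2 ** x 1 - a (d - 1) *\<^sub>R (x 1 ** principal_log (x 1))
      else if i < d then x (i + 1) - a (d - i) *\<^sub>R principal_log (x 1)
      else - (a 0 *\<^sub>R principal_log (x 1)))"

definition log_system ::
  "nat \<Rightarrow> (nat \<Rightarrow> real) \<Rightarrow> ((real^'n^'n) \<times> (real^'n^'n) \<Rightarrow> real^'n^'n) \<Rightarrow>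
   (nat \<Rightarrow> real^'n^'n) \<Rightarrow> nat \<Rightarrow> real^'n^'n" where
  "log_system d a K e i =
     (if i = 1 then e 2 - a (d - 1) *\<^sub>R e 1 + K (e 1, e 2)
      else if i < d then e (i + 1) - a (d - i) *\<^sub>R e 1
      else - (a 0 *\<^sub>R e 1))"

end

theory Submission
  imports Defs "HOL-Computational_Algebra.Fundamental_Theorem_Algebra"
begin

text \<open>
  On the ball the logarithm is \<open>log X = \<integral>\<^sub>0\<^sup>1 (X - 1) R\<^sub>s ds\<close> with the resolvents
  \<open>R\<^sub>s = (1 + s (X - 1))\<^sup>-\<^sup>1\<close>, and its derivative at \<open>X\<close> is \<open>H \<mapsto> \<integral>\<^sub>0\<^sup>1 R\<^sub>s H R\<^sub>s ds\<close>. In a direction \<open>V X\<close>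
  with \<open>V\<close> commuting with \<open>X\<close> this is \<open>V\<close>. The change of coordinates \<open>e\<^sub>1 = log E\<close>
  therefore turns \<open>- a E log E\<close> into \<open>- a e\<^sub>1\<close>, and it turns \<open>e\<^sub>2 E\<close> into \<open>e\<^sub>2\<close> plus the term
  \<open>K(e\<^sub>1, e\<^sub>2) = \<integral>\<^sub>0\<^sup>1 (R\<^sub>s e\<^sub>2 - e\<^sub>2 R\<^sub>s) E R\<^sub>s ds\<close> with \<open>E = exp e\<^sub>1\<close>, which vanishes for commuting
  arguments (lemma \<open>correction_integral_log\<close>). The other equations of the two systems agree.

  The function \<open>K\<close> must be smooth on the whole space, whereas the resolvents exist only where
  \<open>1 + s (exp e\<^sub>1 - 1)\<close> is invertible. So the matrix inverse is multiplied by a smooth cut-off of its own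
  norm. The result extends smoothly by zero over the singular matrices, because the inverse blows up
  there (\<open>Ck_on_truncated_inv\<close>). For \<open>E\<close> in the ball, the norms of all resolvents are bounded in
  terms of \<open>E\<^sup>-\<^sup>1 = exp (- e\<^sub>1)\<close> (\<open>norm_resolvent_le\<close>). That bound is a smooth function of \<open>e\<^sub>1\<close>
  everywhere, so it can serve as the threshold of the cut-off, and the cut-off
  changes nothing on the image of the ball.

  The integral is indeed the principal logarithm (\<open>principal_log_eq\<close>). Its exponential is \<open>X\<close> by a
  differential equation along the segment from the identity to \<open>X\<close>. The location of its eigenvalues, and the
  uniqueness of such a logarithm, follow from common eigenvectors of commuting complex matrices.

  Smoothness of the exponential, of the logarithm and of \<open>K\<close> rests on one fact, that integrals over
  \<open>[0, 1]\<close> of smoothly parametrised functions are smooth (\<open>Ck_on_integral_param\<close>). For the exponential it is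
  applied inductively to Duhamel's formula for the derivative. The image of the ball is open by
  invariance of domain, and the inverse of the logarithm is the exponential.
\<close>


section \<open>Calculus of \<open>k\<close> times continuously differentiable functions\<close>

lemma Ck_on_SucD:
  assumes "Ck_on S (Suc k) f" "x \<in> S"
  shows "(f has_derivative frechet_derivative f (at x)) (at x)"
  using assms by (simp add: frechet_derivative_works)

lemma Ck_on_cong:
  assumes "open S"
  shows "(\<And>x. x \<in> S \<Longrightarrow> f x = g x) \<Longrightarrow> Ck_on S k f \<Longrightarrow> Ck_on S k g"
proof (induction k arbitrary: f g)
  case 0
  then show ?case by (simp cong: continuous_on_cong)
next
  case (Suc k)
  have D: "(g has_derivative frechet_derivative f (at x)) (at x)" if "x \<in> S" for x
    using has_derivative_transform_within_open[OF Ck_on_SucD[OF Suc.prems(2) that] assms that]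
      Suc.prems(1) by auto
  have eq: "frechet_derivative g (at x) = frechet_derivative f (at x)" if "x \<in> S" for x
    using frechet_derivative_at[OF D[OF that]] by simp
  have "Ck_on S k (\<lambda>x. frechet_derivative g (at x) v)" for v
    by (rule Suc.IH[of "\<lambda>x. frechet_derivative f (at x) v"]) (use eq Suc.prems(2) in auto)
  then show ?case using D by (auto simp: differentiable_def)
qed

lemma Ck_on_SucI:
  assumes "open S" "\<And>x. x \<in> S \<Longrightarrow> (f has_derivative D x) (at x)"
    "\<And>v. Ck_on S k (\<lambda>x. D x v)"
  shows "Ck_on S (Suc k) f"
proof -
  have eq: "D x = frechet_derivative f (at x)" if "x \<in> S" for x
    using frechet_derivative_at[OF assms(2)[OF that]] .
  have "Ck_on S k (\<lambda>x. frechet_derivative f (at x) v)" for v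
    by (rule Ck_on_cong[OF assms(1) _ assms(3)[of v]]) (simp add: eq)
  then show ?thesis using assms(2) by (auto simp: differentiable_def)
qed

lemma Ck_on_imp_continuous_on: "Ck_on S k f \<Longrightarrow> continuous_on S f"
  by (cases k)
    (auto intro!: continuous_at_imp_continuous_on differentiable_imp_continuous_within)

lemma Ck_on_Suc_imp: "Ck_on S (Suc k) f \<Longrightarrow> Ck_on S k f"
proof (induction k arbitrary: f)
  case 0
  then show ?case using Ck_on_imp_continuous_on[of S "Suc 0" f] by simp
next
  case (Suc k)
  then show ?case by (metis Ck_on.simps(2))
qed

lemma Ck_on_subset: "Ck_on S k f \<Longrightarrow> T \<subseteq> S \<Longrightarrow> Ck_on T k f"
  by (induction k arbitrary: f) (auto intro: continuous_on_subset)

text \<open>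
  Smoothness is local, so a function given by different formulas near different points is smooth as soon as
  each of these formulas is.
\<close>

lemma Ck_on_local:
  "(\<And>x. x \<in> S \<Longrightarrow> \<exists>T. open T \<and> x \<in> T \<and> Ck_on T k f) \<Longrightarrow> Ck_on S k f"
proof (induction k arbitrary: f)
  case 0
  then show ?case
    by (auto intro!: continuous_at_imp_continuous_on simp: continuous_on_eq_continuous_at)
      (metis continuous_on_eq_continuous_at)
next
  case (Suc k)
  have "Ck_on S k (\<lambda>x. frechet_derivative f (at x) v)" for v
    by (rule Suc.IH) (metis Suc.prems Ck_on.simps(2))
  moreover have "f differentiable (at x)" if "x \<in> S" for x
    using Suc.prems[OF that] by auto
  ultimately show ?case by simp
qed

lemma Ck_on_const: "open S \<Longrightarrow> Ck_on S k (\<lambda>x. c)"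
proof (induction k arbitrary: c)
  case (Suc k)
  then show ?case by (intro Ck_on_SucI[where D="\<lambda>x v. 0"]) auto
qed simp

lemma Ck_on_bounded_linear:
  assumes "open S" "bounded_linear h" shows "Ck_on S k h"
proof (cases k)
  case 0
  then show ?thesis using assms(2) by (simp add: linear_continuous_on)
next
  case (Suc m)
  show ?thesis unfolding Suc
    by (rule Ck_on_SucI[OF assms(1) bounded_linear_imp_has_derivative[OF assms(2)]])
      (rule Ck_on_const[OF assms(1)])
qed

lemma Ck_on_linear_comp:
  assumes "open S" "bounded_linear h"
  shows "Ck_on S k f \<Longrightarrow> Ck_on S k (\<lambda>x. h (f x))"
proof (induction k arbitrary: f)
  case 0
  then show ?case
    using assms(2) by (simp add: bounded_linear.continuous_on)
next
  case (Suc k)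
  show ?case
    by (rule Ck_on_SucI[OF assms(1), where D="\<lambda>x v. h (frechet_derivative f (at x) v)"])
       (use Suc in \<open>auto intro!: bounded_linear.has_derivative[OF assms(2)] Ck_on_SucD\<close>)
qed

lemma Ck_on_add:
  assumes "open S"
  shows "Ck_on S k f \<Longrightarrow> Ck_on S k g \<Longrightarrow> Ck_on S k (\<lambda>x. f x + g x)"
proof (induction k arbitrary: f g)
  case 0
  then show ?case by (simp add: continuous_on_add)
next
  case (Suc k)
  show ?case
    by (rule Ck_on_SucI[OF assms,
          where D="\<lambda>x v. frechet_derivative f (at x) v + frechet_derivative g (at x) v"])
       (use Suc in \<open>auto intro!: has_derivative_add Ck_on_SucD\<close>)
qed

lemma Ck_on_diff:
  assumes "open S" "Ck_on S k f" "Ck_on S k g" shows "Ck_on S k (\<lambda>x. f x - g x)"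
  using Ck_on_add[OF assms(1,2) Ck_on_linear_comp[OF assms(1) bounded_linear_minus[OF bounded_linear_ident] assms(3)]]
  by simp

lemma Ck_on_sum:
  assumes "open S" "\<And>i. i \<in> I \<Longrightarrow> Ck_on S k (f i)" shows "Ck_on S k (\<lambda>x. \<Sum>i\<in>I. f i x)"
  using assms(2) by (induction I rule: infinite_finite_induct) (auto intro: Ck_on_const Ck_on_add assms(1))

lemma Ck_on_bilinear:
  assumes "open S" "bounded_bilinear B"
  shows "Ck_on S k f \<Longrightarrow> Ck_on S k g \<Longrightarrow> Ck_on S k (\<lambda>x. B (f x) (g x))"
proof (induction k arbitrary: f g)
  case 0
  then show ?case using assms(2) by (simp add: bounded_bilinear.continuous_on)
next
  case (Suc k)
  have "Ck_on S k (\<lambda>x. B (f x) (frechet_derivative g (at x) v) + B (frechet_derivative f (at x) v) (g x))"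
    for v
    using Suc by (intro Ck_on_add[OF assms(1)] Suc.IH) (auto intro: Ck_on_Suc_imp simp del: Ck_on.simps, auto)
  then show ?case
    by (intro Ck_on_SucI[OF assms(1)]) (use Suc.prems in
        \<open>auto intro!: bounded_bilinear.FDERIV[OF assms(2)] Ck_on_SucD simp del: Ck_on.simps\<close>)
qed

lemma Ck_on_Pair:
  assumes "open S" "Ck_on S k f" "Ck_on S k g"
  shows "Ck_on S k (\<lambda>x. (f x, g x))"
proof -
  have "bounded_linear (\<lambda>x::'b. (x, 0::'c))" "bounded_linear (\<lambda>x::'c. (0::'b, x))"
    by (auto intro!: bounded_linear_Pair bounded_linear_ident bounded_linear_zero)
  from Ck_on_add[OF assms(1) Ck_on_linear_comp[OF assms(1) this(1) assms(2)]
      Ck_on_linear_comp[OF assms(1) this(2) assms(3)]]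
  show ?thesis by simp
qed

text \<open>
  The derivative of the composition is linear in the derivative of the outer function, so expanding it over a
  basis writes it through the functions \<open>x \<mapsto> Dg (f x) b\<close> with \<open>b\<close> fixed.
  These are again compositions between the same three types, and the induction hypothesis applies to them.
\<close>

lemma Ck_on_compose:
  fixes f :: "'a::euclidean_space \<Rightarrow> 'b::euclidean_space" and g :: "'b \<Rightarrow> 'c::euclidean_space"
  assumes "open S" "open T" "f ` S \<subseteq> T"
  shows "Ck_on S k f \<Longrightarrow> Ck_on T k g \<Longrightarrow> Ck_on S k (\<lambda>x. g (f x))"
proof (induction k arbitrary: g)
  case 0
  then show ?case using assms(3) by (auto intro: continuous_on_compose2)
next
  case (Suc k)
  have D: "((\<lambda>x. g (f x)) has_derivative
      (\<lambda>v. frechet_derivative g (at (f x)) (frechet_derivative f (at x) v))) (at x)" if "x \<in> S" for x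
    using diff_chain_at[OF Ck_on_SucD[OF Suc.prems(1) that] Ck_on_SucD[OF Suc.prems(2)]] that assms(3)
    by (auto simp: o_def)
  have lin: "linear (frechet_derivative g (at (f x)))" if "x \<in> S" for x
    using Ck_on_SucD[OF Suc.prems(2)] that assms(3)
    by (blast intro: has_derivative_linear)
  \<comment> \<open>Only finitely many directions \<open>b\<close> of the outer derivative occur, independent of \<open>x\<close>.\<close>
  have expand: "(\<Sum>b\<in>Basis. (frechet_derivative f (at x) v \<bullet> b) *\<^sub>R frechet_derivative g (at (f x)) b)
     = frechet_derivative g (at (f x)) (frechet_derivative f (at x) v)" if "x \<in> S" for x v
  proof -
    have "frechet_derivative g (at (f x)) (frechet_derivative f (at x) v)
      = frechet_derivative g (at (f x)) (\<Sum>b\<in>Basis. (frechet_derivative f (at x) v \<bullet> b) *\<^sub>R b)"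
      by (simp add: euclidean_representation)
    also have "\<dots> = (\<Sum>b\<in>Basis. (frechet_derivative f (at x) v \<bullet> b) *\<^sub>R frechet_derivative g (at (f x)) b)"
      using lin[OF that] by (simp add: linear_sum linear_cmul)
    finally show ?thesis ..
  qed
  have "Ck_on S k (\<lambda>x. \<Sum>b\<in>Basis. (frechet_derivative f (at x) v \<bullet> b) *\<^sub>R frechet_derivative g (at (f x)) b)" for v
  proof (intro Ck_on_sum[OF assms(1)] Ck_on_bilinear[OF assms(1) bounded_bilinear_scaleR])
    fix b :: 'b assume "b \<in> Basis"
    show "Ck_on S k (\<lambda>x. frechet_derivative f (at x) v \<bullet> b)"
      using Suc.prems(1) by (intro Ck_on_linear_comp[OF assms(1) bounded_linear_inner_left]) auto
    show "Ck_on S k (\<lambda>x. frechet_derivative g (at (f x)) b)"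
      by (rule Suc.IH[OF Ck_on_Suc_imp[OF Suc.prems(1)]]) (use Suc.prems(2) in auto)
  qed
  then have "Ck_on S k (\<lambda>x. frechet_derivative g (at (f x)) (frechet_derivative f (at x) v))" for v
    by (rule Ck_on_cong[OF assms(1) expand, rotated])
  from Ck_on_SucI[OF assms(1) D this] show ?case .
qed

lemma has_derivative_integral_param:
  fixes F :: "real \<times> 'a::euclidean_space \<Rightarrow> 'b::euclidean_space"
  assumes S: "open S" and W: "open W" "{0..1} \<times> S \<subseteq> W" and F: "Ck_on W (Suc 0) F" and x: "x \<in> S"
  shows "((\<lambda>x. integral {0..1} (\<lambda>s. F (s, x))) has_derivative
      (\<lambda>v. integral {0..1} (\<lambda>s. frechet_derivative F (at (s, x)) (0, v)))) (at x)"
proof -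
  define fx where "fx x s = Blinfun (\<lambda>v. frechet_derivative F (at (s, x)) (0, v))" for x s
  obtain r where r: "r > 0" "ball x r \<subseteq> S" using S x openE by blast
  have bl: "bounded_linear (\<lambda>v. frechet_derivative F (at (s, y)) (0, v))" if "(s, y) \<in> W" for s y
  proof -
    have "bounded_linear (frechet_derivative F (at (s, y)))"
      using Ck_on_SucD[OF F that] has_derivative_bounded_linear by blast
    then show ?thesis
      by (rule bounded_linear_compose)
        (auto intro!: bounded_linear_Pair bounded_linear_ident bounded_linear_zero)
  qed
  have app: "blinfun_apply (fx y s) v = frechet_derivative F (at (s, y)) (0, v)" if "(s, y) \<in> W" for s y v
    unfolding fx_def by (simp add: bounded_linear_Blinfun_apply bl[OF that])
  have inW: "(s, y) \<in> W" if "s \<in> {0..1}" "y \<in> ball x r" for s y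
    using that W subsetD[OF r(2)] by blast
  have contD: "continuous_on W (\<lambda>p. frechet_derivative F (at p) v)" for v
    using F by (simp only: Ck_on.simps)
  have contF: "continuous_on W F" using F by (rule Ck_on_imp_continuous_on)
  have cont: "continuous_on (ball x r \<times> cbox 0 1) (\<lambda>(y, s). fx y s)"
  proof -
    have "continuous_on (ball x r \<times> cbox 0 1) (\<lambda>p. fx (fst p) (snd p))"
      unfolding continuous_on_def
    proof (intro ballI tendsto_componentwise1)
      fix p j assume p: "p \<in> ball x r \<times> cbox (0::real) 1"
      have "continuous_on (ball x r \<times> cbox 0 1) (\<lambda>p. frechet_derivative F (at (snd p, fst p)) (0, j))"
        by (rule continuous_on_compose2[OF contD[of "(0,j)"], of _ "\<lambda>p. (snd p, fst p)"])
          (use inW in \<open>auto intro!: continuous_intros\<close>)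
      then have "continuous_on (ball x r \<times> cbox 0 1) (\<lambda>p. blinfun_apply (fx (fst p) (snd p)) j)"
        by (rule continuous_on_eq) (use inW app in auto)
      then show "((\<lambda>p. blinfun_apply (fx (fst p) (snd p)) j) \<longlongrightarrow> blinfun_apply (fx (fst p) (snd p)) j)
          (at p within ball x r \<times> cbox 0 1)"
        using p unfolding continuous_on_def by blast
    qed
    then show ?thesis by (simp add: case_prod_beta)
  qed
  have "((\<lambda>y. integral (cbox 0 1) (\<lambda>s. F (s, y))) has_derivative integral (cbox 0 1) (fx x)) (at x within ball x r)"
  proof (rule leibniz_rule[OF _ _ cont])
    fix y s assume y: "y \<in> ball x r" and s: "s \<in> cbox 0 (1::real)"
    have yW: "(s, y) \<in> W" using inW y s by auto
    have "((\<lambda>y. (s, y)) has_derivative (\<lambda>v. (0, v))) (at y)"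
      by (auto intro!: derivative_eq_intros)
    from diff_chain_at[OF this Ck_on_SucD[OF F yW]]
    show "((\<lambda>y. F (s, y)) has_derivative blinfun_apply (fx y s)) (at y within ball x r)"
      unfolding app[OF yW, abs_def] o_def by (rule has_derivative_at_withinI)
  next
    fix y assume y: "y \<in> ball x r"
    have "continuous_on (cbox 0 1) (\<lambda>s. F (s, y))"
      by (rule continuous_on_compose2[OF contF]) (use inW y in \<open>auto intro!: continuous_intros\<close>)
    then show "(\<lambda>s. F (s, y)) integrable_on cbox 0 1" by (rule integrable_continuous)
  qed (use r in auto)
  then have 1: "((\<lambda>y. integral (cbox 0 1) (\<lambda>s. F (s, y))) has_derivative integral (cbox 0 1) (fx x)) (at x)"
    using at_within_open[of x "ball x r"] r(1) by (metis centre_in_ball open_ball)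
  have "continuous_on (cbox 0 1) (\<lambda>s. (\<lambda>(y, s). fx y s) (x, s))"
    by (rule continuous_on_compose2[OF cont]) (use r in \<open>auto intro!: continuous_intros\<close>)
  then have "continuous_on (cbox 0 1) (fx x)" by simp
  then have "fx x integrable_on cbox 0 1" by (rule integrable_continuous)
  then have "blinfun_apply (integral (cbox 0 1) (fx x)) v
       = integral (cbox 0 1) (\<lambda>s. frechet_derivative F (at (s, x)) (0, v))" for v
    by (subst blinfun_apply_integral) (use app inW r in \<open>auto intro!: integral_cong\<close>)
  then have "blinfun_apply (integral (cbox 0 1) (fx x)) =
       (\<lambda>v. integral (cbox 0 1) (\<lambda>s. frechet_derivative F (at (s, x)) (0, v)))" by auto
  with 1 show ?thesis by simp
qed

text \<open>
  The derivative of the exponential, the logarithm and the correction term are all integrals over the unit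
  interval of smooth integrands; this lemma makes each of them smooth. Differentiation under the integral sign
  reproduces an integral of the same kind, one order lower.
\<close>

lemma Ck_on_integral_param:
  fixes F :: "real \<times> 'a::euclidean_space \<Rightarrow> 'b::euclidean_space"
  assumes S: "open S" and W: "open W" "{0..1} \<times> S \<subseteq> W"
  shows "Ck_on W k F \<Longrightarrow> Ck_on S k (\<lambda>x. integral {0..1} (\<lambda>s. F (s, x)))"
proof (induction k arbitrary: F)
  case 0
  have "continuous_on (S \<times> cbox 0 1) (\<lambda>(x, s). F (s, x))"
    unfolding case_prod_beta
    by (rule continuous_on_compose2[of W F]) (use 0 W in \<open>auto intro!: continuous_intros\<close>)
  from integral_continuous_on_param[OF this] show ?case by simp
next
  case (Suc k)
  have F1: "Ck_on W (Suc 0) F"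
    using Suc.prems by (auto intro: Ck_on_imp_continuous_on)
  show ?case
    by (rule Ck_on_SucI[OF S has_derivative_integral_param[OF S W F1]])
      (use Suc in auto)
qed


section \<open>The matrix exponential\<close>

text \<open>
  The norm of the type is the Frobenius norm; it is submultiplicative by Cauchy-Schwarz.
\<close>

lemma norm_matrix_mult_le:
  fixes A B :: "real^'n^'n"
  shows "norm (A ** B) \<le> norm A * norm B"
proof -
  have row: "norm ((A ** B) $ i) \<le> norm (A $ i) * norm B" for i
  proof -
    have "(A ** B) $ i = (\<Sum>j\<in>UNIV. A $ i $ j *\<^sub>R B $ j)"
      by (simp add: matrix_matrix_mult_def vec_eq_iff)
    then have "norm ((A ** B) $ i) \<le> (\<Sum>j\<in>UNIV. \<bar>A $ i $ j\<bar> * \<bar>norm (B $ j)\<bar>)"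
      by (auto intro!: sum_norm_le)
    also have "\<dots> \<le> L2_set (\<lambda>j. A $ i $ j) UNIV * L2_set (\<lambda>j. norm (B $ j)) UNIV"
      by (rule L2_set_mult_ineq)
    also have "\<dots> = norm (A $ i) * norm B"
      by (simp add: norm_vec_def[of "A $ i"] norm_vec_def[of B] L2_set_def)
    finally show ?thesis .
  qed
  have "norm (A ** B) \<le> L2_set (\<lambda>i. norm (A $ i) * norm B) UNIV"
    unfolding norm_vec_def[of "A ** B"] by (intro L2_set_mono row norm_ge_zero)
  also have "\<dots> = norm A * norm B"
    by (simp add: L2_set_left_distrib[symmetric] norm_vec_def[of A])
  finally show ?thesis .
qed

interpretation matrix_mult: bounded_bilinear "(**) :: real^'n^'n \<Rightarrow> real^'n^'n \<Rightarrow> real^'n^'n"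
proof (unfold_locales, goal_cases)
  case 5
  show ?case by (rule exI[of _ 1]) (simp add: norm_matrix_mult_le)
qed (simp_all add: matrix_matrix_mult_def vec_eq_iff algebra_simps sum.distrib sum_distrib_left)

abbreviation mpow :: "real^'n^'n \<Rightarrow> nat \<Rightarrow> real^'n^'n" where
  "mpow A k \<equiv> ((**) A ^^ k) (mat 1)"

lemma norm_mpow_le: "norm (mpow A k) \<le> norm A ^ k * norm (mat 1 :: real^'n^'n)"
  for A :: "real^'n^'n"
proof (induction k)
  case (Suc k)
  have "norm (A ** mpow A k) \<le> norm A * norm (mpow A k)" by (rule norm_matrix_mult_le)
  also have "\<dots> \<le> norm A * (norm A ^ k * norm (mat 1 :: real^'n^'n))"
    by (intro mult_left_mono Suc) simp
  finally show ?case by (simp add: mult.assoc)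
qed simp

lemma norm_exp_term_le:
  "norm (mpow A k /\<^sub>R fact k) \<le> norm (mat 1 :: real^'n^'n) * (norm A ^ k /\<^sub>R fact k)"
  for A :: "real^'n^'n"
proof -
  have "norm (mpow A k /\<^sub>R fact k) = inverse (fact k) * norm (mpow A k)" by simp
  also have "\<dots> \<le> inverse (fact k) * (norm A ^ k * norm (mat 1 :: real^'n^'n))"
    by (intro mult_left_mono norm_mpow_le) simp
  finally show ?thesis by (simp only: real_scaleR_def mult_ac)
qed

lemma matrix_exp_sums: "(\<lambda>k. mpow A k /\<^sub>R fact k) sums matrix_exp A"
proof -
  have "summable (\<lambda>k. norm (mat 1 :: real^'n^'n) * (norm A ^ k /\<^sub>R fact k))"
    by (intro summable_mult summable_exp_generic)
  then have "summable (\<lambda>k. mpow A k /\<^sub>R fact k)"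
    by (rule summable_comparison_test'[where N=0]) (rule norm_exp_term_le)
  then show ?thesis unfolding matrix_exp_def by (rule summable_sums)
qed

lemma norm_matrix_exp_le:
  "norm (matrix_exp A) \<le> norm (mat 1 :: real^'n^'n) * exp (norm A)" for A :: "real^'n^'n"
proof -
  have "norm (matrix_exp A) \<le> (\<Sum>k. norm (mat 1 :: real^'n^'n) * (norm A ^ k /\<^sub>R fact k))"
    unfolding matrix_exp_def
    by (intro norm_suminf_le norm_exp_term_le summable_mult summable_exp_generic)
  also have "\<dots> = norm (mat 1 :: real^'n^'n) * (\<Sum>k. norm A ^ k /\<^sub>R fact k)"
    by (rule suminf_mult[OF summable_exp_generic])
  finally show ?thesis by (simp only: exp_def)
qed

lemma matrix_exp_commute:
  assumes "B ** A = A ** B" shows "B ** matrix_exp A = matrix_exp A ** B"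
proof -
  have "B ** mpow A k = mpow A k ** B" for k
  proof (induction k)
    case (Suc k)
    then show ?case using assms by (simp, metis matrix_mul_assoc)
  qed simp
  then have "(\<lambda>k. B ** (mpow A k /\<^sub>R fact k)) = (\<lambda>k. (mpow A k /\<^sub>R fact k) ** B)"
    by (simp add: matrix_mult.scaleR_left matrix_mult.scaleR_right)
  then have "(\<lambda>k. B ** (mpow A k /\<^sub>R fact k)) sums (matrix_exp A ** B)"
    using bounded_linear.sums[OF matrix_mult.bounded_linear_left[of B] matrix_exp_sums[of A]] by simp
  with bounded_linear.sums[OF matrix_mult.bounded_linear_right[of B] matrix_exp_sums[of A]]
  show ?thesis by (rule sums_unique2)
qed

lemma mpow_scaleR: "mpow (t *\<^sub>R A) k = t ^ k *\<^sub>R mpow A k"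
proof (induction k)
  case (Suc k)
  have "mpow (t *\<^sub>R A) (Suc k) = (t *\<^sub>R A) ** (t ^ k *\<^sub>R mpow A k)" by (simp add: Suc)
  also have "\<dots> = t ^ Suc k *\<^sub>R (A ** mpow A k)"
    by (simp only: matrix_mult.scaleR_left matrix_mult.scaleR_right scaleR_scaleR power_Suc mult.commute)
  finally show ?case by simp
qed simp

lemma matrix_exp_0 [simp]: "matrix_exp 0 = mat 1"
proof -
  have eq: "mpow (0 :: real^'n^'n) k /\<^sub>R fact k = (if k = 0 then mat 1 else 0)" for k
    by (cases k) (simp_all add: matrix_mult.zero_left)
  have "(\<lambda>k. mpow (0 :: real^'n^'n) k /\<^sub>R fact k) sums (mat 1 :: real^'n^'n)"
    unfolding eq by (rule sums_single[of 0 "\<lambda>_. mat 1 :: real^'n^'n"])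
  with matrix_exp_sums show ?thesis by (rule sums_unique2)
qed

text \<open>
  Every coordinate of \<open>t \<mapsto> exp (t A)\<close> is an everywhere convergent real power series in
  \<open>t\<close>, which may be differentiated term by term.
\<close>

lemma has_vector_derivative_matrix_exp_scaleR:
  "((\<lambda>t. matrix_exp (t *\<^sub>R A)) has_vector_derivative A ** matrix_exp (t *\<^sub>R A)) (at t)"
proof -
  have "((\<lambda>t. matrix_exp (t *\<^sub>R A) \<bullet> b) has_field_derivative ((A ** matrix_exp (t *\<^sub>R A)) \<bullet> b)) (at t)" for b
  proof -
    define c where "c k = (mpow A k \<bullet> b) / fact k" for k
    have s: "(\<lambda>k. c k * x ^ k) sums (matrix_exp (x *\<^sub>R A) \<bullet> b)" for x
      using bounded_linear.sums[OF bounded_linear_inner_left matrix_exp_sums, of "x *\<^sub>R A" b]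
      by (simp add: c_def mpow_scaleR mult_ac divide_inverse)
    have "(\<lambda>k. diffs c k * t ^ k) sums ((A ** matrix_exp (t *\<^sub>R A)) \<bullet> b)"
      using bounded_linear.sums[OF bounded_linear_compose[OF bounded_linear_inner_left matrix_mult.bounded_linear_right]
          matrix_exp_sums, of A "t *\<^sub>R A" b]
      by (simp add: c_def mpow_scaleR diffs_def matrix_mult.scaleR_right divide_simps mult_ac)
    moreover have "(\<lambda>x. \<Sum>k. c k * x ^ k) = (\<lambda>x. matrix_exp (x *\<^sub>R A) \<bullet> b)"
      using s by (simp add: sums_iff)
    moreover have "((\<lambda>x. \<Sum>k. c k * x ^ k) has_field_derivative (\<Sum>k. diffs c k * t ^ k)) (at t)"
      by (rule termdiffs_strong_converges_everywhere) (rule sums_summable[OF s])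
    ultimately show ?thesis by (simp add: sums_iff)
  qed
  then show ?thesis
    unfolding has_vector_derivative_def
    by (subst has_derivative_componentwise_within)
       (auto simp: has_field_derivative_def mult.commute[of _ "_ \<bullet> _"])
qed

lemma matrix_exp_self_commute: "A ** matrix_exp (t *\<^sub>R A) = matrix_exp (t *\<^sub>R A) ** A"
  by (rule matrix_exp_commute) (simp add: matrix_mult.scaleR_left matrix_mult.scaleR_right)

lemma has_vector_derivative_zero_imp_eq:
  fixes f :: "real \<Rightarrow> 'a::real_normed_vector"
  assumes "\<And>t. t \<in> {0..1} \<Longrightarrow> (f has_vector_derivative 0) (at t)"
  shows "f 1 = f 0"
proof -
  obtain c where "\<And>x. x \<in> {0..1} \<Longrightarrow> f x = c"
    using has_vector_derivative_zero_constant[of "{0..1}" f]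
      has_vector_derivative_at_within[OF assms] by auto
  then show ?thesis by simp
qed

lemma matrix_exp_minus: "matrix_exp A ** matrix_exp (- A) = mat 1"
proof -
  have "((\<lambda>t. matrix_exp (t *\<^sub>R A) ** matrix_exp (t *\<^sub>R (- A))) has_vector_derivative 0) (at t)" for t
    using matrix_mult.has_vector_derivative[OF has_vector_derivative_matrix_exp_scaleR[of A t]
        has_vector_derivative_matrix_exp_scaleR[of "- A" t]]
    by (simp only: matrix_exp_self_commute[of A]) (simp add: matrix_mult.minus_right matrix_mult.minus_left matrix_mul_assoc)
  from has_vector_derivative_zero_imp_eq[OF this] show ?thesis by simp
qed

lemma matrix_exp_minus': "matrix_exp (- A) ** matrix_exp A = mat 1"
  using matrix_exp_minus[of "- A"] by simp

text \<open>
  The curve \<open>exp (t (A + B)) exp (- t B) exp (- t A)\<close> is constant, as its derivative vanishes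
  when \<open>A\<close> and \<open>B\<close> commute.
\<close>

lemma matrix_exp_add:
  assumes AB: "A ** B = B ** A" shows "matrix_exp (A + B) = matrix_exp A ** matrix_exp B"
proof -
  let ?g = "\<lambda>t. matrix_exp (t *\<^sub>R (A + B)) ** matrix_exp (t *\<^sub>R (- B)) ** matrix_exp (t *\<^sub>R (- A))"
  have c: "matrix_exp (t *\<^sub>R (- B)) ** A = A ** matrix_exp (t *\<^sub>R (- B))" for t
    by (rule matrix_exp_commute[symmetric])
      (simp add: AB matrix_mult.scaleR_left matrix_mult.scaleR_right matrix_mult.minus_right matrix_mult.minus_left)
  have "(?g has_vector_derivative 0) (at t)" for t
  proof -
    let ?E = "matrix_exp (t *\<^sub>R (A + B))" and ?F = "matrix_exp (t *\<^sub>R (- B))" and ?G = "matrix_exp (t *\<^sub>R (- A))"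
    have "(?g has_vector_derivative ((?E ** ?F) ** (- A ** ?G) + (?E ** (- B ** ?F) + ((A + B) ** ?E) ** ?F) ** ?G)) (at t)"
      by (intro matrix_mult.has_vector_derivative has_vector_derivative_matrix_exp_scaleR)
    moreover have "(?E ** ?F) ** (- A ** ?G) = - (?E ** A ** ?F ** ?G)"
    proof -
      have "(?E ** ?F) ** (- A ** ?G) = - (?E ** (?F ** A) ** ?G)"
        by (simp only: matrix_mult.minus_left matrix_mult.minus_right matrix_mul_assoc)
      then show ?thesis by (simp only: c matrix_mul_assoc)
    qed
    ultimately show ?thesis
      by (simp only: matrix_exp_self_commute[of "A + B"])
        (simp add: matrix_mult.minus_left matrix_mult.minus_right matrix_mult.add_right matrix_mult.add_left matrix_mul_assoc)
  qed
  then have g: "matrix_exp (A + B) ** matrix_exp (- B) ** matrix_exp (- A) = mat 1"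
    using has_vector_derivative_zero_imp_eq[of ?g] by simp
  have "matrix_exp (A + B) = matrix_exp (A + B) ** matrix_exp (- B) ** (matrix_exp (- A) ** matrix_exp A) ** matrix_exp B"
    by (metis matrix_exp_minus' matrix_mul_assoc matrix_mul_rid)
  also have "\<dots> = (matrix_exp (A + B) ** matrix_exp (- B) ** matrix_exp (- A)) ** matrix_exp A ** matrix_exp B"
    by (simp add: matrix_mul_assoc)
  finally show ?thesis by (simp add: g)
qed

lemma integral_0_1_eq_diff:
  fixes f :: "real \<Rightarrow> 'a::banach"
  assumes "\<And>t. t \<in> {0..1} \<Longrightarrow> (f has_vector_derivative f' t) (at t)"
  shows "(f' has_integral (f 1 - f 0)) {0..1}"
  by (rule fundamental_theorem_of_calculus) (simp_all add: has_vector_derivative_at_within assms)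

text \<open>
  Duhamel's formula: the integrand is the derivative of \<open>exp (s X) exp ((1 - s) Y)\<close>. Being an
  exact formula for a difference of exponentials, it yields both the local Lipschitz bound and the derivative.
\<close>

lemma matrix_exp_Duhamel:
  "((\<lambda>s. matrix_exp (s *\<^sub>R X) ** (X - Y) ** matrix_exp ((1 - s) *\<^sub>R Y)) has_integral
     (matrix_exp X - matrix_exp Y)) {0..1}"
proof -
  let ?f = "\<lambda>s. matrix_exp (s *\<^sub>R X) ** matrix_exp ((1 - s) *\<^sub>R Y)"
  have "(?f has_vector_derivative matrix_exp (s *\<^sub>R X) ** (X - Y) ** matrix_exp ((1 - s) *\<^sub>R Y)) (at s)" for s
  proof -
    have d: "((\<lambda>s::real. 1 - s) has_vector_derivative - 1) (at s)" by (auto intro!: derivative_eq_intros)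
    have "((\<lambda>s. matrix_exp ((1 - s) *\<^sub>R Y)) has_vector_derivative - (Y ** matrix_exp ((1 - s) *\<^sub>R Y))) (at s)"
      using vector_diff_chain_at[OF d has_vector_derivative_matrix_exp_scaleR] by (simp add: o_def)
    from matrix_mult.has_vector_derivative[OF has_vector_derivative_matrix_exp_scaleR[of X s] this]
    show ?thesis
      by (simp only: matrix_exp_self_commute[of X])
        (simp add: matrix_mult.minus_right matrix_mult.diff_left matrix_mult.diff_right matrix_mul_assoc)
  qed
  from integral_0_1_eq_diff[OF this] show ?thesis by simp
qed


lemma norm_integral_0_1_le:
  fixes f :: "real \<Rightarrow> 'a::real_normed_vector"
  assumes "(f has_integral i) {0..1}" "0 \<le> B" "\<And>s. s \<in> {0..1} \<Longrightarrow> norm (f s) \<le> B"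
  shows "norm i \<le> B"
  using has_integral_bound_real[OF assms(2) finite.emptyI assms(1)] assms(3) by simp

lemma norm_matrix_exp_diff_le:
  fixes X Y :: "real^'n^'n"
  assumes "norm X \<le> M" "norm Y \<le> M"
  shows "norm (matrix_exp X - matrix_exp Y)
           \<le> (norm (mat 1 :: real^'n^'n) * exp M)\<^sup>2 * norm (X - Y)"
proof -
  let ?c = "norm (mat 1 :: real^'n^'n) * exp M"
  have e: "norm (matrix_exp (r *\<^sub>R A)) \<le> ?c" if "r \<in> {0..1}" "norm A \<le> M" for r and A :: "real^'n^'n"
  proof -
    have "norm (r *\<^sub>R A) \<le> M"
      using that mult_right_mono[of r 1 "norm A"] by simp
    then have "norm (mat 1 :: real^'n^'n) * exp (norm (r *\<^sub>R A)) \<le> ?c"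
      by (intro mult_left_mono) auto
    with norm_matrix_exp_le[of "r *\<^sub>R A"] show ?thesis by linarith
  qed
  have "norm (matrix_exp X - matrix_exp Y) \<le> (?c * norm (X - Y) * ?c)"
  proof (rule norm_integral_0_1_le[OF matrix_exp_Duhamel[of X Y]])
    fix s :: real assume s: "s \<in> {0..1}"
    have "norm (matrix_exp (s *\<^sub>R X) ** (X - Y) ** matrix_exp ((1 - s) *\<^sub>R Y))
       \<le> norm (matrix_exp (s *\<^sub>R X) ** (X - Y)) * norm (matrix_exp ((1 - s) *\<^sub>R Y))"
      by (rule norm_matrix_mult_le)
    also have "\<dots> \<le> (norm (matrix_exp (s *\<^sub>R X)) * norm (X - Y)) * norm (matrix_exp ((1 - s) *\<^sub>R Y))"
      by (intro mult_right_mono norm_matrix_mult_le norm_ge_zero)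
    also have "\<dots> \<le> (?c * norm (X - Y)) * ?c"
      using s assms by (intro mult_mono e) auto
    finally show "norm (matrix_exp (s *\<^sub>R X) ** (X - Y) ** matrix_exp ((1 - s) *\<^sub>R Y)) \<le> ?c * norm (X - Y) * ?c" .
  qed simp
  then show ?thesis by (simp add: power2_eq_square mult_ac)
qed

lemma continuous_on_matrix_exp_scaleR [continuous_intros]:
  assumes "continuous_on S f"
  shows "continuous_on S (\<lambda>s. matrix_exp (f s *\<^sub>R A))"
proof -
  have "continuous_on UNIV (\<lambda>s. matrix_exp (s *\<^sub>R A))"
    by (intro continuous_at_imp_continuous_on ballI
        has_vector_derivative_continuous[OF has_vector_derivative_matrix_exp_scaleR])
  from continuous_on_compose2[OF this assms] show ?thesis by simp
qed

lemma continuous_on_matrix_mult [continuous_intros]: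
  fixes f g :: "'a::topological_space \<Rightarrow> real^'n^'n"
  shows "continuous_on S f \<Longrightarrow> continuous_on S g \<Longrightarrow> continuous_on S (\<lambda>x. f x ** g x)"
  by (rule matrix_mult.continuous_on)

text \<open>
  Subtracting the candidate derivative from Duhamel's formula leaves
  \<open>(exp (s Z) - exp (s Y)) (Z - Y) exp ((1 - s) Y)\<close> under the integral, which is quadratic in
  \<open>Z - Y\<close> by the Lipschitz bound.
\<close>

lemma has_derivative_matrix_exp:
  fixes Y :: "real^'n^'n"
  shows "(matrix_exp has_derivative
    (\<lambda>V. integral {0..1} (\<lambda>s. matrix_exp (s *\<^sub>R Y) ** V ** matrix_exp ((1 - s) *\<^sub>R Y)))) (at Y)"
    (is "(_ has_derivative ?D) _")
proof -
  let ?c = "norm (mat 1 :: real^'n^'n) * exp (norm Y + 1)"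
  have int: "(\<lambda>s. matrix_exp (s *\<^sub>R X) ** V ** matrix_exp ((1 - s) *\<^sub>R Y)) integrable_on {0..1}"
    for X V :: "real^'n^'n"
    by (intro integrable_continuous_interval continuous_intros)
  have lin: "linear ?D"
  proof
    show "?D (V + W) = ?D V + ?D W" for V W
      by (simp add: matrix_mult.add_left matrix_mult.add_right integral_add int)
    show "?D (r *\<^sub>R V) = r *\<^sub>R ?D V" for r V
      by (simp add: matrix_mult.scaleR_left matrix_mult.scaleR_right)
  qed
  show ?thesis
  proof (rule has_derivativeI_sandwich[where e=1 and H="\<lambda>Z. ?c ^ 3 * norm (Z - Y)"])
    show "bounded_linear ?D" using lin by (rule linear_linear[THEN iffD2])
  next
    fix Z assume Z: "Z \<noteq> Y" "dist Z Y < 1"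
    have nZ: "norm Z \<le> norm Y + 1"
      using Z(2) norm_triangle_sub[of Z Y] by (simp add: dist_norm)
    have e: "norm (matrix_exp (r *\<^sub>R Y)) \<le> ?c" if "r \<in> {0..1}" for r
    proof -
      have "norm (r *\<^sub>R Y) \<le> norm Y + 1"
        using that mult_right_mono[of r 1 "norm Y"] by simp
      then have "norm (mat 1 :: real^'n^'n) * exp (norm (r *\<^sub>R Y)) \<le> ?c"
        by (intro mult_left_mono) auto
      with norm_matrix_exp_le[of "r *\<^sub>R Y"] show ?thesis by linarith
    qed
    have "((\<lambda>s. matrix_exp (s *\<^sub>R Z) ** (Z - Y) ** matrix_exp ((1 - s) *\<^sub>R Y)
             - matrix_exp (s *\<^sub>R Y) ** (Z - Y) ** matrix_exp ((1 - s) *\<^sub>R Y))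
          has_integral (matrix_exp Z - matrix_exp Y - ?D (Z - Y))) {0..1}"
      by (intro has_integral_diff matrix_exp_Duhamel integrable_integral int)
    then have "norm (matrix_exp Z - matrix_exp Y - ?D (Z - Y)) \<le> (?c ^ 3 * (norm (Z - Y))\<^sup>2)"
    proof (rule norm_integral_0_1_le)
      fix s :: real assume s: "s \<in> {0..1}"
      have "norm (matrix_exp (s *\<^sub>R Z) - matrix_exp (s *\<^sub>R Y)) \<le> ?c\<^sup>2 * norm (s *\<^sub>R Z - s *\<^sub>R Y)"
      proof (rule norm_matrix_exp_diff_le)
        show "norm (s *\<^sub>R Z) \<le> norm Y + 1"
          using s nZ mult_right_mono[of s 1 "norm Z"] by simp
        show "norm (s *\<^sub>R Y) \<le> norm Y + 1"
          using s mult_right_mono[of s 1 "norm Y"] by simp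
      qed
      also have "norm (s *\<^sub>R Z - s *\<^sub>R Y) \<le> norm (Z - Y)"
        using s mult_right_mono[of s 1 "norm (Z - Y)"] by (simp flip: scaleR_diff_right)
      finally have d: "norm (matrix_exp (s *\<^sub>R Z) - matrix_exp (s *\<^sub>R Y)) \<le> ?c\<^sup>2 * norm (Z - Y)"
        by (simp add: mult_left_mono)
      let ?T = "(matrix_exp (s *\<^sub>R Z) - matrix_exp (s *\<^sub>R Y)) ** (Z - Y) ** matrix_exp ((1 - s) *\<^sub>R Y)"
      have "norm ?T \<le> norm ((matrix_exp (s *\<^sub>R Z) - matrix_exp (s *\<^sub>R Y)) ** (Z - Y)) * norm (matrix_exp ((1 - s) *\<^sub>R Y))"
        by (rule norm_matrix_mult_le)
      also have "\<dots> \<le> (norm (matrix_exp (s *\<^sub>R Z) - matrix_exp (s *\<^sub>R Y)) * norm (Z - Y)) * norm (matrix_exp ((1 - s) *\<^sub>R Y))"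
        by (intro mult_right_mono norm_matrix_mult_le norm_ge_zero)
      also have "\<dots> \<le> ((?c\<^sup>2 * norm (Z - Y)) * norm (Z - Y)) * ?c"
        using s by (intro mult_mono d e) auto
      also have "\<dots> = ?c ^ 3 * (norm (Z - Y))\<^sup>2"
        by (simp add: power2_eq_square power3_eq_cube)
      finally show "norm (matrix_exp (s *\<^sub>R Z) ** (Z - Y) ** matrix_exp ((1 - s) *\<^sub>R Y)
             - matrix_exp (s *\<^sub>R Y) ** (Z - Y) ** matrix_exp ((1 - s) *\<^sub>R Y)) \<le> ?c ^ 3 * (norm (Z - Y))\<^sup>2"
        by (simp add: matrix_mult.diff_left)
    qed simp
    then show "norm (matrix_exp Z - matrix_exp Y - ?D (Z - Y)) / norm (Z - Y) \<le> ?c ^ 3 * norm (Z - Y)"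
      using Z(1) by (simp add: pos_divide_le_eq power2_eq_square mult.assoc)
  next
    have "((\<lambda>Z. ?c ^ 3 * norm (Z - Y)) \<longlongrightarrow> ?c ^ 3 * norm (Y - Y)) (at Y)"
      by (intro tendsto_intros)
    then show "((\<lambda>Z. ?c ^ 3 * norm (Z - Y)) \<longlongrightarrow> 0) (at Y)" by simp
  qed simp
qed

lemma integral_Duhamel_commuting:
  assumes "V ** Y = Y ** V"
  shows "integral {0..1} (\<lambda>s. matrix_exp (s *\<^sub>R Y) ** V ** matrix_exp ((1 - s) *\<^sub>R Y)) = matrix_exp Y ** V"
proof -
  have "matrix_exp (s *\<^sub>R Y) ** V ** matrix_exp ((1 - s) *\<^sub>R Y) = matrix_exp Y ** V" for s
  proof -
    have "V ** matrix_exp ((1 - s) *\<^sub>R Y) = matrix_exp ((1 - s) *\<^sub>R Y) ** V"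
      by (rule matrix_exp_commute) (simp add: assms matrix_mult.scaleR_left matrix_mult.scaleR_right)
    then have "matrix_exp (s *\<^sub>R Y) ** V ** matrix_exp ((1 - s) *\<^sub>R Y)
       = matrix_exp (s *\<^sub>R Y) ** matrix_exp ((1 - s) *\<^sub>R Y) ** V"
      by (metis matrix_mul_assoc)
    also have "matrix_exp (s *\<^sub>R Y) ** matrix_exp ((1 - s) *\<^sub>R Y) = matrix_exp (s *\<^sub>R Y + (1 - s) *\<^sub>R Y)"
      by (rule matrix_exp_add[symmetric]) (simp add: matrix_mult.scaleR_left matrix_mult.scaleR_right)
    also have "s *\<^sub>R Y + (1 - s) *\<^sub>R Y = Y" by (simp flip: scaleR_left_distrib)
    finally show ?thesis .
  qed
  then show ?thesis by simp
qed

lemma Ck_on_matrix_mult: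
  fixes f g :: "'a::euclidean_space \<Rightarrow> real^'n^'n"
  assumes "open S" "Ck_on S k f" "Ck_on S k g" shows "Ck_on S k (\<lambda>x. f x ** g x)"
  using assms by (intro Ck_on_bilinear[OF _ matrix_mult.bounded_bilinear_axioms])

lemma Ck_on_scaleR:
  fixes f :: "'a::euclidean_space \<Rightarrow> real" and g :: "'a \<Rightarrow> 'b::euclidean_space"
  assumes "open S" "Ck_on S k f" "Ck_on S k g" shows "Ck_on S k (\<lambda>x. f x *\<^sub>R g x)"
  using assms by (intro Ck_on_bilinear[OF _ bounded_bilinear_scaleR])

lemma Ck_on_fst: "open S \<Longrightarrow> Ck_on S k fst"
  and Ck_on_snd: "open S \<Longrightarrow> Ck_on S k snd"
  by (rule Ck_on_bounded_linear[OF _ bounded_linear_fst] Ck_on_bounded_linear[OF _ bounded_linear_snd];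
      assumption)+

text \<open>
  A bootstrap: if the exponential is of class \<open>k\<close>, so is the integrand of its derivative, hence
  the derivative itself.
\<close>

lemma Ck_on_matrix_exp: "Ck_on UNIV k (matrix_exp :: real^'n^'n \<Rightarrow> _)"
proof (induction k)
  case 0
  show ?case
    by (simp, intro continuous_at_imp_continuous_on ballI has_derivative_continuous[OF has_derivative_matrix_exp])
next
  case (Suc k)
  have "Ck_on UNIV k (\<lambda>p. matrix_exp (fst p *\<^sub>R snd p) ** V ** matrix_exp ((1 - fst p) *\<^sub>R (snd p :: real^'n^'n)))" for V
    by (intro Ck_on_matrix_mult Ck_on_compose[OF _ _ _ _ Suc] Ck_on_scaleR Ck_on_diff Ck_on_const Ck_on_fst Ck_on_snd)
      auto
  from Ck_on_integral_param[OF _ _ _ this] 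
  show ?case by (intro Ck_on_SucI[OF _ has_derivative_matrix_exp]) auto
qed


section \<open>The matrix inverse and its smooth truncation\<close>

lemma matrix_inv_left_right:
  assumes "invertible A" shows "matrix_inv A ** A = mat 1" "A ** matrix_inv A = mat 1"
  using someI_ex[OF assms[unfolded invertible_def]] by (simp_all add: matrix_inv_def)

lemma matrix_inv_commute:
  fixes A V :: "real^'n^'n"
  assumes "invertible A" "V ** A = A ** V" shows "V ** matrix_inv A = matrix_inv A ** V"
proof -
  have "V ** matrix_inv A = (matrix_inv A ** A) ** V ** matrix_inv A"
    by (simp add: matrix_inv_left_right[OF assms(1)])
  also have "\<dots> = matrix_inv A ** (V ** A) ** matrix_inv A"
    by (simp only: assms(2) matrix_mul_assoc)
  also have "\<dots> = matrix_inv A ** V ** (A ** matrix_inv A)" by (simp only: matrix_mul_assoc)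
  finally show ?thesis by (simp add: matrix_inv_left_right[OF assms(1)])
qed

lemma norm_matrix_vector_mult_le: "norm (A *v x) \<le> norm A * norm x" for A :: "real^'n^'n"
proof -
  have "norm (A *v x) \<le> L2_set (\<lambda>i. norm (A $ i) * norm x) UNIV"
    unfolding norm_vec_def[of "A *v x"]
    by (intro L2_set_mono) (simp_all add: matrix_vector_mul_component Cauchy_Schwarz_ineq2)
  also have "\<dots> = norm A * norm x"
    by (simp add: L2_set_left_distrib[symmetric] norm_vec_def[of A])
  finally show ?thesis .
qed

lemma not_invertible_ker:
  fixes A :: "real^'n^'n"
  assumes "\<not> invertible A" obtains v where "v \<noteq> 0" "A *v v = 0"
  using assms matrix_left_invertible_ker[of A] by (auto simp: invertible_def matrix_left_right_inverse)

text \<open>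
  A vector in the kernel of \<open>X\<close> shows that the inverse of \<open>A\<close> is at least as large
  as the reciprocal of the distance from \<open>A\<close> to the singular matrix \<open>X\<close>. So the
  invertible matrices form an open set, and the inverse blows up at its boundary.
\<close>

lemma norm_inv_mult_dist_singular_ge:
  fixes A X :: "real^'n^'n"
  assumes "invertible A" "\<not> invertible X" shows "1 \<le> norm (matrix_inv A) * norm (A - X)"
proof -
  obtain v where v: "v \<noteq> 0" "X *v v = 0" using not_invertible_ker[OF assms(2)] .
  have "v = matrix_inv A *v ((A - X) *v v)"
    by (simp add: matrix_vector_mult_diff_rdistrib v matrix_vector_mul_assoc matrix_inv_left_right[OF assms(1)])
  then have "norm v \<le> norm (matrix_inv A) * norm ((A - X) *v v)"
    using norm_matrix_vector_mult_le by metis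
  also have "\<dots> \<le> norm (matrix_inv A) * (norm (A - X) * norm v)"
    by (intro mult_left_mono norm_matrix_vector_mult_le) simp
  finally show ?thesis using v(1) by (simp flip: mult.assoc)
qed

lemma open_invertible: "open {A :: real^'n^'n. invertible A}"
  unfolding open_dist
proof safe
  fix A :: "real^'n^'n" assume A: "invertible A"
  have "invertible X" if "dist X A < inverse (norm (matrix_inv A) + 1)" for X
  proof (rule ccontr)
    assume "\<not> invertible X"
    then have "1 \<le> norm (matrix_inv A) * norm (A - X)" by (rule norm_inv_mult_dist_singular_ge[OF A])
    also have "\<dots> \<le> (norm (matrix_inv A) + 1) * norm (A - X)" by (intro mult_right_mono) auto
    also have "\<dots> < (norm (matrix_inv A) + 1) * inverse (norm (matrix_inv A) + 1)"
      using that by (intro mult_strict_left_mono) (auto simp: dist_norm norm_minus_commute add_nonneg_pos)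
    also have "\<dots> = 1" using norm_ge_zero[of "matrix_inv A"] by (simp del: norm_ge_zero)
    finally show False by simp
  qed
  then show "\<exists>e>0. \<forall>X. dist X A < e \<longrightarrow> X \<in> Collect invertible"
    by (intro exI[of _ "inverse (norm (matrix_inv A) + 1)"]) (auto simp: add_nonneg_pos)
qed

text \<open>
  From \<open>X\<^sup>-\<^sup>1 - A\<^sup>-\<^sup>1 = X\<^sup>-\<^sup>1 (A - X) A\<^sup>-\<^sup>1\<close>:
  near \<open>A\<close> this bounds \<open>X\<^sup>-\<^sup>1\<close>, and inserted into itself it shows that
  the linear approximation has a quadratic error.
\<close>

lemma has_derivative_matrix_inv:
  fixes A :: "real^'n^'n"
  assumes A: "invertible A"
  shows "(matrix_inv has_derivative (\<lambda>H. - (matrix_inv A ** H ** matrix_inv A))) (at A)"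
proof -
  let ?N = "norm (matrix_inv A) + 1"
  have N: "?N > 0" "norm (matrix_inv A) \<le> ?N" by (auto simp: add_nonneg_pos)
  show ?thesis
  proof (rule has_derivativeI_sandwich[where e="inverse (2 * ?N)" and H="\<lambda>X. 2 * ?N ^ 3 * norm (X - A)"])
    show "bounded_linear (\<lambda>H. - (matrix_inv A ** H ** matrix_inv A))"
      by (intro bounded_linear_minus bounded_linear_compose[OF matrix_mult.bounded_linear_left matrix_mult.bounded_linear_right])
  next
    fix X assume X: "X \<noteq> A" "dist X A < inverse (2 * ?N)"
    have small: "norm (A - X) * ?N < 1/2"
    proof -
      have "norm (A - X) * ?N < inverse (2 * ?N) * ?N"
        using X(2) N(1) by (intro mult_strict_right_mono) (auto simp: dist_norm norm_minus_commute)
      moreover have "inverse (2 * c) * c = 1/2" if "c > 0" for c :: real using that by simp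
      ultimately show ?thesis using N(1) by metis
    qed
    have inv: "invertible X"
    proof (rule ccontr)
      assume "\<not> invertible X"
      from norm_inv_mult_dist_singular_ge[OF A this] small
        mult_right_mono[OF N(2), of "norm (A - X)"]
      show False by (simp add: mult.commute)
    qed
    let ?X = "matrix_inv X" and ?A = "matrix_inv A"
    have diff: "?X - ?A = ?X ** (A - X) ** ?A"
    proof -
      have "?X ** (A - X) ** ?A = ?X ** (A ** ?A) - (?X ** X) ** ?A"
        by (simp only: matrix_mult.diff_left matrix_mult.diff_right matrix_mul_assoc)
      then show ?thesis by (simp add: matrix_inv_left_right inv A)
    qed
    have nd: "norm (?X - ?A) \<le> norm ?X * norm (A - X) * norm ?A"
      unfolding diff
      by (rule order_trans[OF norm_matrix_mult_le]) (intro mult_right_mono norm_matrix_mult_le norm_ge_zero)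
    also have "\<dots> \<le> norm ?X * (norm (A - X) * ?N)"
      unfolding mult.assoc by (intro mult_left_mono N(2)) auto
    also have "\<dots> \<le> norm ?X * (1/2)" using small by (intro mult_left_mono) auto
    finally have "norm (?X - ?A) \<le> norm ?X / 2" by simp
    then have nX: "norm ?X \<le> 2 * ?N"
      using norm_triangle_sub[of ?X ?A] by simp
    have "?X - ?A - - (?A ** (X - A) ** ?A) = (?X - ?A) ** (A - X) ** ?A"
      by (subst diff) (simp add: diff[symmetric] matrix_mult.diff_left matrix_mult.diff_right)
    then have "norm (?X - ?A - - (?A ** (X - A) ** ?A)) \<le> norm (?X - ?A) * norm (A - X) * norm ?A"
      by (simp, intro order_trans[OF norm_matrix_mult_le] mult_right_mono norm_matrix_mult_le norm_ge_zero)
    also have "\<dots> \<le> ((2 * ?N) * norm (A - X) * ?N) * norm (A - X) * ?N"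
      using N by (intro mult_mono order_trans[OF nd] nX) auto
    also have "\<dots> = 2 * ?N ^ 3 * norm (X - A) * norm (X - A)"
      by (simp add: power3_eq_cube norm_minus_commute)
    finally show "norm (?X - ?A - - (?A ** (X - A) ** ?A)) / norm (X - A) \<le> 2 * ?N ^ 3 * norm (X - A)"
      using X(1) by (simp add: pos_divide_le_eq)
  next
    have "((\<lambda>X. 2 * ?N ^ 3 * norm (X - A)) \<longlongrightarrow> 2 * ?N ^ 3 * norm (A - A)) (at A)"
      by (intro tendsto_intros)
    then show "((\<lambda>X. 2 * ?N ^ 3 * norm (X - A)) \<longlongrightarrow> 0) (at A)" by simp
  qed (use N in simp)
qed

lemma Ck_on_matrix_inv: "Ck_on {A :: real^'n^'n. invertible A} k matrix_inv"
proof (induction k)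
  case 0
  show ?case
    by (simp, intro continuous_at_imp_continuous_on ballI has_derivative_continuous[OF has_derivative_matrix_inv])
      simp
next
  case (Suc k)
  show ?case
    by (intro Ck_on_SucI[OF open_invertible has_derivative_matrix_inv]
        Ck_on_linear_comp[OF open_invertible bounded_linear_minus[OF bounded_linear_ident]]
        Ck_on_matrix_mult open_invertible Suc Ck_on_const) simp
qed

text \<open>
  The powers of \<open>x\<close> in the denominator make the family closed under differentiation, so that all
  of its members can be shown to be smooth in one induction.
\<close>

definition flat :: "nat \<Rightarrow> real \<Rightarrow> real" where
  "flat m x = (if x > 0 then exp (- (1 / x)) / x ^ m else 0)"

text \<open>
  The exponential series dominates its term of degree \<open>m + 2\<close>, so each member of the family
  vanishes to second order at the origin.
\<close>

lemma flat_le: "\<bar>flat m x\<bar> \<le> fact (m + 2) * x\<^sup>2"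
proof (cases "x > 0")
  case True
  have "(1 / x) ^ (m + 2) /\<^sub>R fact (m + 2) \<le> exp (1 / x)"
    unfolding exp_def using True sum_le_suminf[OF summable_exp_generic[of "1 / x"], of "{m + 2}"] by simp
  moreover have "p \<le> c * e" if "c > 0" "p /\<^sub>R c \<le> e" for p c e :: real
    using that by (simp add: field_simps)
  ultimately have "1 / (x ^ m * x\<^sup>2) \<le> fact (m + 2) * exp (1 / x)"
    by (metis fact_gt_zero power_add power_one_over)
  moreover have "inverse e / p \<le> c * x\<^sup>2" if "1 / (p * x\<^sup>2) \<le> c * e" "p > 0" "e > 0" for p c e :: real
    using that True by (simp add: field_simps)
  ultimately have "exp (- (1 / x)) / x ^ m \<le> fact (m + 2) * x\<^sup>2"
    using True by (simp add: exp_minus)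
  then show ?thesis using True by (simp add: flat_def)
qed (simp add: flat_def)

lemma DERIV_flat: "(flat m has_field_derivative flat (m + 2) x - m * flat (m + 1) x) (at x)"
proof -
  consider "x > 0" | "x < 0" | "x = 0" by linarith
  then show ?thesis
  proof cases
    case 1
    have "((\<lambda>x. exp (- (1 / x)) / x ^ m) has_field_derivative flat (m + 2) x - m * flat (m + 1) x) (at x)"
    proof (cases m)
      case 0
      then show ?thesis using 1
        by (auto intro!: derivative_eq_intros simp: flat_def power2_eq_square)
    next
      case (Suc n)
      have D: "((\<lambda>x. x ^ m) has_field_derivative m * x ^ n) (at x)"
        using DERIV_pow[of m x] Suc by simp
      have "((\<lambda>x. exp (- (1 / x)) / x ^ m) has_field_derivative
         (exp (- (1 / x)) * (1 / x\<^sup>2) * x ^ m - exp (- (1 / x)) * (m * x ^ n)) / (x ^ m * x ^ m)) (at x)"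
        using 1 by (auto intro!: derivative_eq_intros D simp: power2_eq_square) (use Suc in auto)
      also have "(exp (- (1 / x)) * (1 / x\<^sup>2) * x ^ m - exp (- (1 / x)) * (m * x ^ n)) / (x ^ m * x ^ m)
          = flat (m + 2) x - m * flat (m + 1) x"
        using 1 Suc by (simp add: flat_def field_simps power2_eq_square)
      finally show ?thesis .
    qed
    then show ?thesis
      by (rule has_field_derivative_transform_within_open[of _ _ _ "{0<..}"]) (use 1 in \<open>auto simp: flat_def\<close>)
  next
    case 2
    have "((\<lambda>x. 0) has_field_derivative flat (m + 2) x - m * flat (m + 1) x) (at x)"
      using 2 by (simp add: flat_def)
    then show ?thesis
      by (rule has_field_derivative_transform_within_open[of _ _ _ "{..<0}"]) (use 2 in \<open>auto simp: flat_def\<close>)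
  next
    case 3
    have "(flat m has_derivative (\<lambda>h. 0)) (at 0)"
    proof (rule has_derivativeI_sandwich[where e=1 and H="\<lambda>y. fact (m + 2) * \<bar>y\<bar>"])
      fix y :: real assume "y \<noteq> 0"
      then show "norm (flat m y - flat m 0 - 0) / norm (y - 0) \<le> fact (m + 2) * \<bar>y\<bar>"
        using flat_le[of m y] by (simp add: flat_def[of m 0] pos_divide_le_eq power2_eq_square mult.assoc abs_mult_self_eq)
    next
      have "((\<lambda>y::real. fact (m + 2) * \<bar>y\<bar>) \<longlongrightarrow> fact (m + 2) * \<bar>0\<bar>) (at 0)"
        by (intro tendsto_intros)
      then show "((\<lambda>y::real. fact (m + 2) * \<bar>y\<bar>) \<longlongrightarrow> 0) (at 0)" by simp
    qed auto
    moreover have "(*) (0 :: real) = (\<lambda>h. 0)" by auto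
    ultimately show ?thesis using 3 by (simp add: has_field_derivative_def flat_def)
  qed
qed

lemma Ck_on_flat: "Ck_on UNIV k (flat m)"
proof (induction k arbitrary: m)
  case 0
  show ?case by (simp, intro continuous_at_imp_continuous_on ballI DERIV_isCont[OF DERIV_flat])
next
  case (Suc k)
  show ?case
    by (rule Ck_on_SucI[OF open_UNIV DERIV_flat[unfolded has_field_derivative_def]])
      (intro Ck_on_bilinear[OF open_UNIV bounded_bilinear_mult] Ck_on_diff Ck_on_const Suc open_UNIV)
qed

lemma Ck_on_inverse_real: "Ck_on {x :: real. x \<noteq> 0} k inverse"
proof (induction k)
  case 0
  show ?case by (auto intro!: continuous_intros)
next
  case (Suc k)
  have o: "open {x :: real. x \<noteq> 0}" by (simp add: open_Collect_neq)
  show ?case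
    by (rule Ck_on_SucI[OF o has_derivative_inverse'])
      (auto intro!: Ck_on_bilinear[OF o bounded_bilinear_mult] Ck_on_const o Suc
        Ck_on_linear_comp[OF o bounded_linear_minus[OF bounded_linear_ident]])
qed

definition smooth_step :: "real \<Rightarrow> real" where
  "smooth_step x = flat 0 x * inverse (flat 0 x + flat 0 (1 - x))"

lemma smooth_step_eq_0: "x \<le> 0 \<Longrightarrow> smooth_step x = 0"
  and smooth_step_eq_1: "1 \<le> x \<Longrightarrow> smooth_step x = 1"
  by (simp_all add: smooth_step_def flat_def)

lemma Ck_on_smooth_step: "Ck_on UNIV k smooth_step"
proof -
  have pos: "flat 0 x + flat 0 (1 - x) > 0" for x
    by (simp add: flat_def add_pos_pos)
  have "Ck_on UNIV k (\<lambda>x. flat 0 (1 - x))"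
    by (rule Ck_on_compose[OF _ _ _ _ Ck_on_flat])
      (auto intro!: Ck_on_diff Ck_on_const Ck_on_bounded_linear[OF _ bounded_linear_ident])
  then have "Ck_on UNIV k (\<lambda>x. inverse (flat 0 x + flat 0 (1 - x)))"
    by (intro Ck_on_compose[OF _ _ _ _ Ck_on_inverse_real] Ck_on_add Ck_on_flat)
      (use pos in \<open>auto simp: open_Collect_neq less_imp_neq[symmetric]\<close>)
  then have "Ck_on UNIV k (\<lambda>x. flat 0 x * inverse (flat 0 x + flat 0 (1 - x)))"
    by (intro Ck_on_bilinear[OF open_UNIV bounded_bilinear_mult] Ck_on_flat)
  then show ?thesis by (simp add: smooth_step_def[abs_def])
qed

text \<open>
  Equal to the inverse where its squared norm is at most \<open>snd p\<close>, and zero where it is at least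
  \<open>snd p + 1\<close>. The inverse blows up at singular matrices, hence the truncation vanishes near them
  and is smooth on the whole matrix space. As a scalar multiple of the inverse it commutes with whatever
  commutes with the matrix.
\<close>

definition truncated_inv :: "(real^'n^'n) \<times> real \<Rightarrow> real^'n^'n" where
  "truncated_inv p = (if invertible (fst p)
     then smooth_step (1 + snd p - (norm (matrix_inv (fst p)))\<^sup>2) *\<^sub>R matrix_inv (fst p) else 0)"

lemma truncated_inv_eq:
  "invertible X \<Longrightarrow> (norm (matrix_inv X))\<^sup>2 \<le> q \<Longrightarrow> truncated_inv (X, q) = matrix_inv X"
  by (simp add: truncated_inv_def smooth_step_eq_1)

lemma truncated_inv_commute:
  fixes X V :: "real^'n^'n"
  assumes "V ** X = X ** V" shows "V ** truncated_inv (X, q) = truncated_inv (X, q) ** V"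
  using matrix_inv_commute[OF _ assms]
  by (simp add: truncated_inv_def matrix_mult.scaleR_left matrix_mult.scaleR_right
      matrix_mult.zero_left matrix_mult.zero_right)

lemma Ck_on_truncated_inv: "Ck_on UNIV k (truncated_inv :: (real^'n^'n) \<times> real \<Rightarrow> _)"
proof (rule Ck_on_local)
  fix p :: "(real^'n^'n) \<times> real"
  obtain X q where p: "p = (X, q)" by (cases p)
  show "\<exists>T. open T \<and> p \<in> T \<and> Ck_on T k (truncated_inv :: (real^'n^'n) \<times> real \<Rightarrow> _)"
  proof (cases "invertible X")
    case True
    let ?T = "{A :: real^'n^'n. invertible A} \<times> (UNIV :: real set)"
    have T: "open ?T" by (intro open_Times open_invertible open_UNIV)
    have i: "Ck_on ?T k (\<lambda>p. matrix_inv (fst p))"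
      by (rule Ck_on_compose[OF T open_invertible _ _ Ck_on_matrix_inv]) (auto intro: Ck_on_fst[OF T])
    have "Ck_on ?T k (\<lambda>p. smooth_step (1 + snd p - inner (matrix_inv (fst p)) (matrix_inv (fst p))) *\<^sub>R matrix_inv (fst p))"
      by (intro Ck_on_scaleR[OF T] i Ck_on_compose[OF T open_UNIV _ _ Ck_on_smooth_step] Ck_on_diff[OF T]
          Ck_on_add[OF T] Ck_on_const[OF T] Ck_on_snd[OF T] Ck_on_bilinear[OF T bounded_bilinear_inner]) auto
    then have "Ck_on ?T k (truncated_inv :: (real^'n^'n) \<times> real \<Rightarrow> _)"
      by (rule Ck_on_cong[OF T, rotated]) (auto simp: truncated_inv_def power2_norm_eq_inner)
    then show ?thesis using T p True by (intro exI[of _ ?T]) auto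
  next
    case False
    \<comment> \<open>On this neighbourhood the inverse, where it exists, is too large to survive the cut-off.\<close>
    let ?T = "{r :: (real^'n^'n) \<times> real. (norm (fst r - X))\<^sup>2 * (1 + \<bar>snd r\<bar>) < 1}"
    have T: "open ?T" by (intro open_Collect_less continuous_intros)
    have "truncated_inv r = 0" if r: "r \<in> ?T" for r
    proof (cases "invertible (fst r)")
      case True
      let ?i = "norm (matrix_inv (fst r))" and ?d = "norm (fst r - X)"
      have 1: "1 \<le> ?i * ?d" by (rule norm_inv_mult_dist_singular_ge[OF True False])
      have "?d\<^sup>2 * (1 + snd r) \<le> ?d\<^sup>2 * (1 + \<bar>snd r\<bar>)" by (intro mult_left_mono) auto
      also have "\<dots> < 1" using r by simp
      also have "1 \<le> ?d\<^sup>2 * ?i\<^sup>2"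
        using power_mono[OF 1, of 2] by (simp add: power_mult_distrib mult.commute)
      finally have "1 + snd r < ?i\<^sup>2"
        by (meson mult_less_cancel_left_pos mult_left_mono not_le zero_le_power2)
      then show ?thesis by (simp add: truncated_inv_def smooth_step_eq_0)
    qed (simp add: truncated_inv_def)
    then have "Ck_on ?T k (truncated_inv :: (real^'n^'n) \<times> real \<Rightarrow> _)"
      by (intro Ck_on_cong[OF T _ Ck_on_const[OF T, of k 0]]) simp
    then show ?thesis using T p by (intro exI[of _ ?T]) auto
  qed
qed


section \<open>The logarithm on the unit ball around the identity\<close>

lemma norm_matrix_vector_mult_le_onorm: "norm (A *v x) \<le> onorm ((*v) A) * norm x"
  for A :: "real^'n^'n"
  by (rule onorm[OF matrix_vector_mul_bounded_linear])

lemma onorm_matrix_le_norm: "onorm ((*v) A) \<le> norm A" for A :: "real^'n^'n"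
  by (rule onorm_le) (rule norm_matrix_vector_mult_le)

lemma mem_matrix_ball_1: "X \<in> matrix_ball (mat 1) 1 \<longleftrightarrow> onorm ((*v) (X - mat 1)) < 1"
proof -
  have "(*v) (mat 1 - X) = (\<lambda>v. - ((X - mat 1) *v v))"
    by (auto simp: matrix_vector_mult_diff_rdistrib)
  then show ?thesis by (simp add: matrix_ball_def onorm_neg)
qed

lemma open_matrix_ball: "open (matrix_ball (A :: real^'n^'n) r)"
  unfolding open_dist
proof
  fix X assume X: "X \<in> matrix_ball A r"
  let ?e = "r - onorm ((*v) (A - X))"
  have "Y \<in> matrix_ball A r" if "dist Y X < ?e" for Y
  proof -
    have "(*v) (A - Y) = (\<lambda>v. (A - X) *v v + (X - Y) *v v)"
      by (auto simp: matrix_vector_mult_diff_rdistrib)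
    then have "onorm ((*v) (A - Y)) \<le> onorm ((*v) (A - X)) + onorm ((*v) (X - Y))"
      using onorm_triangle[OF matrix_vector_mul_bounded_linear[of "A - X"] matrix_vector_mul_bounded_linear[of "X - Y"]]
      by simp
    also have "\<dots> < r" using onorm_matrix_le_norm[of "X - Y"] that by (simp add: dist_norm norm_minus_commute)
    finally show ?thesis by (simp add: matrix_ball_def)
  qed
  moreover have "?e > 0" using X by (simp add: matrix_ball_def)
  ultimately show "\<exists>e>0. \<forall>y. dist y X < e \<longrightarrow> y \<in> matrix_ball A r" by blast
qed

definition segment_to :: "real \<Rightarrow> real^'n^'n \<Rightarrow> real^'n^'n" where
  "segment_to s X = mat 1 + s *\<^sub>R (X - mat 1)"

definition resolvent :: "real \<Rightarrow> real^'n^'n \<Rightarrow> real^'n^'n" where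
  "resolvent s X = matrix_inv (segment_to s X)"

text \<open>
  The matrix version of \<open>log x = \<integral>\<^sub>0\<^sup>1 (x - 1) / (1 + s (x - 1)) ds\<close>.
  Unlike the power series, this formula gives the derivative of the logarithm as an explicit integral of the
  same type.
\<close>

definition integral_log :: "real^'n^'n \<Rightarrow> real^'n^'n" where
  "integral_log X = integral {0..1} (\<lambda>s. (X - mat 1) ** resolvent s X)"

lemma invertible_segment_to:
  fixes X :: "real^'n^'n"
  assumes X: "X \<in> matrix_ball (mat 1) 1" and s: "s \<in> {0..1}"
  shows "invertible (segment_to s X)"
proof (rule ccontr)
  assume "\<not> invertible (segment_to s X)"
  then obtain v where v: "v \<noteq> 0" "segment_to s X *v v = 0" by (rule not_invertible_ker)
  have "v = - s *\<^sub>R ((X - mat 1) *v v)"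
    using v(2) by (simp add: segment_to_def matrix_vector_mult_add_rdistrib eq_neg_iff_add_eq_0 flip: scaleR_matrix_vector_assoc)
  then have "norm v = \<bar>s\<bar> * norm ((X - mat 1) *v v)" by (metis norm_scaleR abs_minus_cancel)
  also have "\<dots> \<le> 1 * (onorm ((*v) (X - mat 1)) * norm v)"
    using s by (intro mult_mono norm_matrix_vector_mult_le_onorm) auto
  also have "\<dots> < norm v" using X v(1) by (simp add: mem_matrix_ball_1)
  finally show False by simp
qed

lemma segment_to_in_ball:
  fixes X :: "real^'n^'n"
  assumes X: "X \<in> matrix_ball (mat 1) 1" and s: "s \<in> {0..1}"
  shows "segment_to s X \<in> matrix_ball (mat 1) 1"
proof -
  have "(*v) (segment_to s X - mat 1) = (\<lambda>v. s *\<^sub>R ((X - mat 1) *v v))"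
    by (auto simp: segment_to_def simp flip: scaleR_matrix_vector_assoc)
  then have "onorm ((*v) (segment_to s X - mat 1)) = \<bar>s\<bar> * onorm ((*v) (X - mat 1))"
    by (simp add: onorm_scaleR)
  also have "\<dots> \<le> 1 * onorm ((*v) (X - mat 1))"
    using s by (intro mult_right_mono onorm_pos_le) auto
  finally show ?thesis using X by (simp add: mem_matrix_ball_1)
qed

lemma segment_to_commute: "V ** X = X ** V \<Longrightarrow> V ** segment_to s X = segment_to s X ** V"
  for V X :: "real^'n^'n"
  by (simp add: segment_to_def matrix_mult.add_left matrix_mult.add_right matrix_mult.diff_left
      matrix_mult.diff_right matrix_mult.scaleR_left matrix_mult.scaleR_right)

lemma Ck_on_segment_to: "open S \<Longrightarrow> Ck_on S k (\<lambda>p. segment_to (fst p) (snd p))"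
  unfolding segment_to_def
  by (intro Ck_on_add Ck_on_const Ck_on_scaleR Ck_on_fst Ck_on_diff Ck_on_snd)

definition resolvent_domain :: "(real \<times> (real^'n^'n)) set" where
  "resolvent_domain = {p. invertible (segment_to (fst p) (snd p))}"

lemma open_resolvent_domain: "open resolvent_domain"
proof -
  have "continuous_on UNIV (\<lambda>p :: real \<times> (real^'n^'n). segment_to (fst p) (snd p))"
    by (rule Ck_on_imp_continuous_on[OF Ck_on_segment_to[OF open_UNIV, of 0]])
  from open_vimage[OF open_invertible this] show ?thesis
    by (simp add: resolvent_domain_def vimage_def)
qed

lemma ball_subset_resolvent_domain: "{0..1} \<times> matrix_ball (mat 1) 1 \<subseteq> resolvent_domain"
  by (auto simp: resolvent_domain_def invertible_segment_to)

lemma Ck_on_resolvent: "Ck_on resolvent_domain k (\<lambda>p. resolvent (fst p) (snd p))"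
  unfolding resolvent_def
  by (rule Ck_on_compose[OF open_resolvent_domain open_invertible _ _ Ck_on_matrix_inv])
    (auto simp: resolvent_domain_def intro: Ck_on_segment_to[OF open_resolvent_domain[unfolded resolvent_domain_def]])

lemma Ck_on_log_integrand: "Ck_on resolvent_domain k (\<lambda>p. (snd p - mat 1) ** resolvent (fst p) (snd p))"
  by (intro Ck_on_matrix_mult Ck_on_resolvent Ck_on_diff Ck_on_snd Ck_on_const open_resolvent_domain)

lemma Ck_on_integral_log: "Ck_on (matrix_ball (mat 1) 1) k integral_log"
  using Ck_on_integral_param[OF open_matrix_ball open_resolvent_domain ball_subset_resolvent_domain Ck_on_log_integrand]
  by (simp add: integral_log_def[abs_def])

lemma continuous_on_resolvent:
  "X \<in> matrix_ball (mat 1) 1 \<Longrightarrow> continuous_on {0..1} (\<lambda>s. resolvent s X)"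
  by (rule continuous_on_compose2[OF Ck_on_imp_continuous_on[OF Ck_on_resolvent[of 0]], of _ "\<lambda>s. (s, X)", simplified])
    (use ball_subset_resolvent_domain in \<open>auto intro!: continuous_intros\<close>)

lemma resolvent_identity:
  assumes "X \<in> matrix_ball (mat 1) 1" "s \<in> {0..1}"
  shows "mat 1 - s *\<^sub>R ((X - mat 1) ** resolvent s X) = resolvent s X"
proof -
  have "segment_to s X ** resolvent s X = mat 1"
    unfolding resolvent_def by (rule matrix_inv_left_right[OF invertible_segment_to[OF assms]])
  then have "resolvent s X + s *\<^sub>R ((X - mat 1) ** resolvent s X) = mat 1"
    by (simp add: segment_to_def matrix_mult.add_left matrix_mult.scaleR_left)
  then show ?thesis by (simp add: algebra_simps)
qed

lemma resolvent_commute: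
  fixes V X :: "real^'n^'n"
  assumes "X \<in> matrix_ball (mat 1) 1" "s \<in> {0..1}" "V ** X = X ** V"
  shows "V ** resolvent s X = resolvent s X ** V"
  unfolding resolvent_def
  by (intro matrix_inv_commute invertible_segment_to segment_to_commute assms)

lemma has_derivative_resolvent:
  assumes "invertible (segment_to s X)"
  shows "((\<lambda>Y. resolvent s Y) has_derivative (\<lambda>H. - (resolvent s X ** (s *\<^sub>R H) ** resolvent s X))) (at X)"
proof -
  have "((\<lambda>Y. segment_to s Y) has_derivative (\<lambda>H. s *\<^sub>R H)) (at X)"
    unfolding segment_to_def by (auto intro!: derivative_eq_intros)
  from has_derivative_compose[OF this has_derivative_matrix_inv[OF assms]]
  show ?thesis by (simp add: resolvent_def)
qed

text \<open>
  The derivative of the integrand in the direction \<open>H\<close> is \<open>H R - s (X - 1) R H R\<close>,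
  where \<open>R\<close> is the resolvent, and \<open>1 - s (X - 1) R = R\<close> turns it into
  \<open>R H R\<close>.
\<close>

lemma has_derivative_integral_log:
  fixes X :: "real^'n^'n"
  assumes X: "X \<in> matrix_ball (mat 1) 1"
  shows "(integral_log has_derivative
    (\<lambda>H. integral {0..1} (\<lambda>s. resolvent s X ** H ** resolvent s X))) (at X)"
proof -
  let ?F = "\<lambda>p :: real \<times> (real^'n^'n). (snd p - mat 1) ** resolvent (fst p) (snd p)"
  have eq: "frechet_derivative ?F (at (s, X)) (0, H) = resolvent s X ** H ** resolvent s X"
    if s: "s \<in> {0..1}" for s H
  proof -
    have "(s, X) \<in> resolvent_domain" using ball_subset_resolvent_domain X s by blast
    from Ck_on_SucD[OF Ck_on_log_integrand this]
    have F: "(?F has_derivative frechet_derivative ?F (at (s, X))) (at (s, X))" .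
    have "((\<lambda>Y. (s, Y)) has_derivative (\<lambda>v. (0, v))) (at X)" by (auto intro!: derivative_eq_intros)
    from has_derivative_compose[OF this F]
    have 1: "((\<lambda>Y. (Y - mat 1) ** resolvent s Y) has_derivative (\<lambda>H. frechet_derivative ?F (at (s, X)) (0, H))) (at X)"
      by simp
    have "((\<lambda>Y. Y - mat 1) has_derivative (\<lambda>H. H)) (at X)" by (auto intro!: derivative_eq_intros)
    from matrix_mult.FDERIV[OF this has_derivative_resolvent[OF invertible_segment_to[OF X s]]]
    have 2: "((\<lambda>Y. (Y - mat 1) ** resolvent s Y) has_derivative
      (\<lambda>H. (X - mat 1) ** - (resolvent s X ** (s *\<^sub>R H) ** resolvent s X) + H ** resolvent s X)) (at X)" .
    have c: "(X - mat 1) ** resolvent s X = resolvent s X ** (X - mat 1)"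
      by (rule resolvent_commute[OF X s]) (simp add: matrix_mult.diff_left matrix_mult.diff_right)
    have "frechet_derivative ?F (at (s, X)) (0, H) = (X - mat 1) ** - (resolvent s X ** (s *\<^sub>R H) ** resolvent s X) + H ** resolvent s X"
      using has_derivative_unique[OF 1 2] by metis
    also have "\<dots> = (mat 1 - s *\<^sub>R ((X - mat 1) ** resolvent s X)) ** H ** resolvent s X"
      by (simp add: matrix_mult.diff_left matrix_mult.minus_right matrix_mult.scaleR_left matrix_mult.scaleR_right matrix_mul_assoc)
    finally show ?thesis by (simp only: resolvent_identity[OF X s])
  qed
  have "integral {0..1} (\<lambda>s. frechet_derivative ?F (at (s, X)) (0, H)) = integral {0..1} (\<lambda>s. resolvent s X ** H ** resolvent s X)" for H
    by (intro integral_cong eq)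
  with has_derivative_integral_param[OF open_matrix_ball open_resolvent_domain ball_subset_resolvent_domain Ck_on_log_integrand X]
  show ?thesis by (simp add: integral_log_def[abs_def])
qed

lemma has_vector_derivative_compose:
  assumes "(f has_vector_derivative f') (at t)" "(g has_derivative g') (at (f t))"
  shows "((\<lambda>t. g (f t)) has_vector_derivative g' f') (at t)"
  using has_derivative_compose[OF assms(1)[unfolded has_vector_derivative_def] assms(2)]
    linear_cmul[OF has_derivative_linear[OF assms(2)]]
  by (simp add: has_vector_derivative_def)

lemma has_vector_derivative_segment_to:
  "((\<lambda>s. segment_to s X) has_vector_derivative (X - mat 1)) (at s)"
  unfolding segment_to_def has_vector_derivative_def by (auto intro!: derivative_eq_intros)

text \<open>
  The integrand is the derivative of \<open>s X R\<close> with respect to \<open>s\<close>. So the derivative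
  of the logarithm at \<open>X\<close> in the direction \<open>X\<close> is the identity, and in a direction
  \<open>V X\<close> with \<open>V\<close> commuting with \<open>X\<close> it is \<open>V\<close>.
\<close>

lemma has_integral_resolvent_self:
  fixes X :: "real^'n^'n"
  assumes X: "X \<in> matrix_ball (mat 1) 1"
  shows "((\<lambda>s. resolvent s X ** X ** resolvent s X) has_integral mat 1) {0..1}"
proof -
  let ?R = "\<lambda>s. resolvent s X"
  have "((\<lambda>s. s *\<^sub>R (X ** ?R s)) has_vector_derivative ?R s ** X ** ?R s) (at s)" if s: "s \<in> {0..1}" for s
  proof -
    have "(?R has_vector_derivative - (?R s ** (X - mat 1) ** ?R s)) (at s)"
      unfolding resolvent_def
      by (rule has_vector_derivative_compose[OF has_vector_derivative_segment_to has_derivative_matrix_inv[OF invertible_segment_to[OF X s]]])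
    from bounded_linear.has_vector_derivative[OF matrix_mult.bounded_linear_right this]
    have "((\<lambda>s. X ** ?R s) has_vector_derivative X ** - (?R s ** (X - mat 1) ** ?R s)) (at s)" .
    from has_vector_derivative_scaleR[OF DERIV_ident this]
    have "((\<lambda>s. s *\<^sub>R (X ** ?R s)) has_vector_derivative s *\<^sub>R (X ** - (?R s ** (X - mat 1) ** ?R s)) + 1 *\<^sub>R (X ** ?R s)) (at s)" .
    also have "s *\<^sub>R (X ** - (?R s ** (X - mat 1) ** ?R s)) + 1 *\<^sub>R (X ** ?R s)
       = (X ** ?R s) ** (mat 1 - s *\<^sub>R ((X - mat 1) ** ?R s))"
      by (simp add: matrix_mult.diff_right matrix_mult.minus_right matrix_mult.scaleR_right matrix_mul_assoc)
    also have "\<dots> = ?R s ** X ** ?R s"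
      by (simp only: resolvent_identity[OF X s] resolvent_commute[OF X s refl])
    finally show ?thesis .
  qed
  from integral_0_1_eq_diff[OF this]
  have "((\<lambda>s. ?R s ** X ** ?R s) has_integral (X ** ?R 1)) {0..1}" by simp
  moreover have "X ** ?R 1 = mat 1"
    using matrix_inv_left_right(2)[OF invertible_segment_to[OF X, of 1]] by (simp add: resolvent_def segment_to_def)
  ultimately show ?thesis by simp
qed

lemma integral_log_derivative_commuting:
  fixes X V :: "real^'n^'n"
  assumes X: "X \<in> matrix_ball (mat 1) 1" and V: "V ** X = X ** V"
  shows "((\<lambda>s. resolvent s X ** (V ** X) ** resolvent s X) has_integral V) {0..1}"
proof -
  have int: "((\<lambda>s. V ** (resolvent s X ** X ** resolvent s X)) has_integral V ** mat 1) {0..1}"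
    using has_integral_linear[OF has_integral_resolvent_self[OF X] matrix_mult.bounded_linear_right]
    by (simp add: o_def)
  have "V ** (resolvent s X ** X ** resolvent s X) = resolvent s X ** (V ** X) ** resolvent s X" if "s \<in> {0..1}" for s
    by (simp only: matrix_mul_assoc resolvent_commute[OF X that V])
  from has_integral_eq[OF this int] show ?thesis by simp
qed

lemma integral_log_commute:
  fixes X V :: "real^'n^'n"
  assumes X: "X \<in> matrix_ball (mat 1) 1" and V: "V ** X = X ** V"
  shows "V ** integral_log X = integral_log X ** V"
proof -
  have int: "(\<lambda>s. (X - mat 1) ** resolvent s X) integrable_on {0..1}"
    by (intro integrable_continuous_interval continuous_intros continuous_on_resolvent X)
  have "V ** integral_log X = integral {0..1} (\<lambda>s. V ** ((X - mat 1) ** resolvent s X))"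
    using integral_linear[OF int matrix_mult.bounded_linear_right] by (simp add: integral_log_def o_def)
  also have "\<dots> = integral {0..1} (\<lambda>s. ((X - mat 1) ** resolvent s X) ** V)"
  proof (rule integral_cong)
    fix s :: real assume s: "s \<in> {0..1}"
    have "V ** (X - mat 1) = (X - mat 1) ** V" by (simp add: V matrix_mult.diff_left matrix_mult.diff_right)
    then show "V ** ((X - mat 1) ** resolvent s X) = ((X - mat 1) ** resolvent s X) ** V"
      by (metis resolvent_commute[OF X s V] matrix_mul_assoc)
  qed
  also have "\<dots> = integral_log X ** V"
    using integral_linear[OF int matrix_mult.bounded_linear_left] by (simp add: integral_log_def o_def)
  finally show ?thesis .
qed

text \<open>
  Along the segment \<open>X\<^sub>t\<close> from the identity to \<open>X\<close> everything commutes, and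
  \<open>exp (- log X\<^sub>t) X\<^sub>t\<close> has derivative zero; at \<open>t = 0\<close> it is the
  identity.
\<close>

lemma matrix_exp_integral_log:
  fixes X :: "real^'n^'n"
  assumes X: "X \<in> matrix_ball (mat 1) 1"
  shows "matrix_exp (integral_log X) = X"
proof -
  let ?X = "\<lambda>t. segment_to t X"
  let ?f = "\<lambda>t. matrix_exp (- integral_log (?X t)) ** ?X t"
  have "(?f has_vector_derivative 0) (at t)" if t: "t \<in> {0..1}" for t
  proof -
    have B: "?X t \<in> matrix_ball (mat 1) 1" by (rule segment_to_in_ball[OF X t])
    note inv = matrix_inv_left_right[OF invertible_segment_to[OF X t]]
    define V where "V = (X - mat 1) ** matrix_inv (?X t)"
    have VX: "V ** ?X t = X - mat 1"
      unfolding V_def by (simp only: matrix_mul_assoc[symmetric] inv matrix_mul_rid)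
    have c: "(X - mat 1) ** ?X t = ?X t ** (X - mat 1)"
      by (rule segment_to_commute) (simp add: matrix_mult.diff_left matrix_mult.diff_right)
    have XV: "?X t ** V = X - mat 1"
      unfolding V_def by (simp only: matrix_mul_assoc c[symmetric]) (simp only: matrix_mul_assoc[symmetric] inv matrix_mul_rid)
    have VL: "V ** integral_log (?X t) = integral_log (?X t) ** V"
      by (rule integral_log_commute[OF B]) (simp only: VX XV)
    have "((\<lambda>t. integral_log (?X t)) has_vector_derivative V) (at t)"
    proof -
      have "integral {0..1} (\<lambda>s. resolvent s (?X t) ** (X - mat 1) ** resolvent s (?X t)) = V"
        using integral_log_derivative_commuting[OF B, of V] VX XV by (simp add: integral_unique)
      with has_vector_derivative_compose[OF has_vector_derivative_segment_to has_derivative_integral_log[OF B]]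
      show ?thesis by simp
    qed
    then have L: "((\<lambda>t. - integral_log (?X t)) has_vector_derivative - V) (at t)"
      by (rule has_vector_derivative_minus)
    have "((\<lambda>t. matrix_exp (- integral_log (?X t))) has_vector_derivative matrix_exp (- integral_log (?X t)) ** - V) (at t)"
      using has_vector_derivative_compose[OF L has_derivative_matrix_exp]
      by (subst (asm) integral_Duhamel_commuting)
        (simp_all add: VL matrix_mult.minus_left matrix_mult.minus_right)
    from matrix_mult.has_vector_derivative[OF this has_vector_derivative_segment_to]
    have "(?f has_vector_derivative matrix_exp (- integral_log (?X t)) ** (X - mat 1)
        + matrix_exp (- integral_log (?X t)) ** - V ** ?X t) (at t)" .
    moreover have "matrix_exp (- integral_log (?X t)) ** - V ** ?X t = - (matrix_exp (- integral_log (?X t)) ** (V ** ?X t))"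
      by (simp add: matrix_mult.minus_left matrix_mult.minus_right matrix_mul_assoc)
    ultimately show ?thesis by (simp add: VX)
  qed
  from has_vector_derivative_zero_imp_eq[of ?f, OF this]
  have "matrix_exp (- integral_log X) ** X = mat 1"
    by (simp add: segment_to_def integral_log_def matrix_mult.zero_left)
  then have "matrix_exp (integral_log X) ** (matrix_exp (- integral_log X) ** X) = matrix_exp (integral_log X)" by simp
  then show ?thesis by (simp add: matrix_mul_assoc matrix_exp_minus)
qed


section \<open>Common eigenvectors of commuting complex matrices\<close>

text \<open>
  The vector \<open>p(A) v\<close>, evaluated by Horner's scheme.
\<close>

definition poly_act :: "complex^'n^'n \<Rightarrow> complex^'n \<Rightarrow> complex poly \<Rightarrow> complex^'n" where
  "poly_act A v p = fold_coeffs (\<lambda>a w. a *s v + A *v w) p 0"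

lemma poly_act_0 [simp]: "poly_act A v 0 = 0"
  by (simp add: poly_act_def)

lemma poly_act_pCons [simp]: "poly_act A v (pCons a p) = a *s v + A *v poly_act A v p"
  by (cases "p = 0 \<and> a = 0") (auto simp: poly_act_def)

lemma poly_act_add: "poly_act A v (p + q) = poly_act A v p + poly_act A v q"
  by (induction p q rule: poly_induct2)
    (simp_all add: vector_sadd_rdistrib matrix_vector_right_distrib algebra_simps)

lemma poly_act_smult: "poly_act A v (smult c p) = c *s poly_act A v p"
  by (induction p) (simp_all add: vector_ssub_ldistrib vector_add_ldistrib vector_scalar_commute)

lemma poly_act_diff: "poly_act A v (p - q) = poly_act A v p - poly_act A v q"
  using poly_act_add[of A v p "smult (- 1) q"] poly_act_smult[of A v "- 1" q] by simp

lemma poly_act_monom: "poly_act A v (monom c i) = c *s ((*v) A ^^ i) v"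
  by (induction i) (simp_all add: monom_0 monom_Suc vector_scalar_commute)

lemma poly_act_sum: "poly_act A v (\<Sum>i\<in>I. f i) = (\<Sum>i\<in>I. poly_act A v (f i))"
  by (induction I rule: infinite_finite_induct) (simp_all add: poly_act_add)

lemma poly_act_in_invariant_subspace:
  assumes "vec.subspace V" "v \<in> V" "\<And>w. w \<in> V \<Longrightarrow> A *v w \<in> V"
  shows "poly_act A v p \<in> V"
  by (induction p) (auto intro!: vec.subspace_add vec.subspace_scale vec.subspace_0 assms)

lemma exists_annihilating_poly:
  fixes A :: "complex^'n^'n"
  shows "\<exists>p. p \<noteq> 0 \<and> poly_act A v p = 0"
proof -
  let ?f = "\<lambda>i. ((*v) A ^^ i) v" and ?I = "{..CARD('n)}"
  show ?thesis
  proof (cases "inj_on ?f ?I")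
    case True
    have "vec.dependent (?f ` ?I)"
    proof (rule ccontr)
      assume "\<not> vec.dependent (?f ` ?I)"
      then have "card (?f ` ?I) \<le> vec.dim (UNIV :: (complex^'n) set)"
        by (intro vec.independent_card_le_dim) auto
      then show False by (simp add: card_image[OF True] vec.dim_UNIV card_cart_basis)
    qed
    then obtain u where u: "\<exists>w\<in>?f ` ?I. u w \<noteq> 0" "(\<Sum>w\<in>?f ` ?I. u w *s w) = 0"
      by (subst (asm) vec.dependent_finite) auto
    let ?p = "\<Sum>i\<in>?I. monom (u (?f i)) i"
    have "poly_act A v ?p = 0"
      using u(2) by (simp add: poly_act_sum poly_act_monom sum.reindex[OF True])
    moreover obtain i where i: "i \<in> ?I" "u (?f i) \<noteq> 0" using u(1) by auto
    have "coeff ?p i = u (?f i)" using i(1) by (simp add: coeff_sum)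
    then have "?p \<noteq> 0" using i(2) by auto
    ultimately show ?thesis by blast
  next
    case False
    then obtain i j where ij: "i \<noteq> j" "?f i = ?f j" by (auto simp: inj_on_def)
    let ?p = "monom 1 i + smult (- 1) (monom 1 j) :: complex poly"
    have "poly_act A v ?p = 0" using ij by (simp only: poly_act_add poly_act_smult poly_act_monom) simp
    moreover have "coeff ?p i = 1" using ij by simp
    then have "?p \<noteq> 0" by (metis coeff_0 zero_neq_one)
    ultimately show ?thesis by blast
  qed
qed

text \<open>
  Take a polynomial of least degree with \<open>p(A) v = 0\<close>, and divide it by a linear factor
  \<open>x - c\<close>. The quotient does not annihilate \<open>v\<close>, and it maps \<open>v\<close> to an
  eigenvector for \<open>c\<close>, which is in the invariant subspace again.
\<close>

lemma invariant_subspace_eigenvector: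
  fixes A :: "complex^'n^'n"
  assumes V: "vec.subspace V" "\<And>w. w \<in> V \<Longrightarrow> A *v w \<in> V" and v: "v \<in> V" "v \<noteq> 0"
  obtains c w where "w \<in> V" "w \<noteq> 0" "A *v w = c *s w"
proof -
  obtain p where p: "p \<noteq> 0" "poly_act A v p = 0"
    and min: "\<And>q. q \<noteq> 0 \<Longrightarrow> poly_act A v q = 0 \<Longrightarrow> degree p \<le> degree q"
    using ex_has_least_nat[of "\<lambda>p. p \<noteq> 0 \<and> poly_act A v p = 0" _ degree] exists_annihilating_poly[of A v]
    by blast
  have "degree p \<noteq> 0"
  proof
    assume "degree p = 0"
    then obtain a where "p = [:a:]" by (rule degree_eq_zeroE)
    with p v(2) show False by simp
  qed
  then obtain c where "poly p c = 0"
    using fundamental_theorem_of_algebra[of p] by (auto simp: constant_degree)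
  then obtain q where q: "p = [:- c, 1:] * q" by (auto simp: poly_eq_0_iff_dvd)
  have "q \<noteq> 0" using p(1) q by auto
  then have "degree p = Suc (degree q)" unfolding q by (subst degree_mult_eq) auto
  then have nz: "poly_act A v q \<noteq> 0" using min[OF \<open>q \<noteq> 0\<close>] by auto
  have "poly_act A v p = - c *s poly_act A v q + A *v poly_act A v q"
    unfolding q by (simp add: poly_act_diff poly_act_smult)
  then have "A *v poly_act A v q = c *s poly_act A v q"
    using p(2) by (simp add: eq_neg_iff_add_eq_0)
  with nz that poly_act_in_invariant_subspace[OF V(1) v(1) V(2)] show ?thesis by blast
qed

text \<open>
  An eigenspace of \<open>A\<close> within the subspace is invariant under \<open>B\<close>.
\<close>

lemma common_eigenvector:
  fixes A B :: "complex^'n^'n"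
  assumes V: "vec.subspace V" "\<And>w. w \<in> V \<Longrightarrow> A *v w \<in> V" "\<And>w. w \<in> V \<Longrightarrow> B *v w \<in> V"
    and v: "v \<in> V" "v \<noteq> 0" and AB: "A ** B = B ** A"
  obtains a b w where "w \<in> V" "w \<noteq> 0" "A *v w = a *s w" "B *v w = b *s w"
proof -
  obtain a u where u: "u \<in> V" "u \<noteq> 0" "A *v u = a *s u"
    by (rule invariant_subspace_eigenvector[OF V(1,2) v])
  let ?W = "{w \<in> V. A *v w = a *s w}"
  have "vec.subspace ?W"
    using V(1) by (auto simp: vec.subspace_def matrix_vector_right_distrib vector_add_ldistrib
        vector_scalar_commute vector_smult_assoc mult.commute)
  moreover have "B *v w \<in> ?W" if "w \<in> ?W" for w
  proof -
    have "A *v (B *v w) = B *v (A *v w)" by (simp add: matrix_vector_mul_assoc AB)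
    then show ?thesis using that V(3) by (auto simp: vector_scalar_commute)
  qed
  moreover have "u \<in> ?W" using u by simp
  ultimately obtain b w where "w \<in> ?W" "w \<noteq> 0" "B *v w = b *s w"
    using u(2) by (rule invariant_subspace_eigenvector)
  then show ?thesis using that by blast
qed

section \<open>The principal logarithm\<close>

abbreviation cmat :: "real^'n^'n \<Rightarrow> complex^'n^'n" where
  "cmat \<equiv> map_matrix complex_of_real"

lemma cmat_mult: "cmat (A ** B) = cmat A ** cmat B"
  by (simp add: matrix_matrix_mult_def vec_eq_iff)

lemma cmat_1: "cmat (mat 1) = mat 1"
  by (simp add: mat_def vec_eq_iff)

lemma bounded_linear_cmat: "bounded_linear (\<lambda>A :: real^'n^'n. cmat A *v v)"
proof -
  have "linear (\<lambda>A :: real^'n^'n. cmat A *v v)"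
    by (rule linearI) (simp_all add: matrix_vector_mult_def vec_eq_iff algebra_simps sum.distrib scaleR_sum_right
        scaleR_conv_of_real[where 'a=complex] sum_distrib_left)
  then show ?thesis by (simp add: linear_linear)
qed

lemma bounded_linear_scalar_left: "bounded_linear (\<lambda>z :: complex. z *s (v :: complex^'n))"
proof -
  have "linear (\<lambda>z :: complex. z *s v)"
    by (rule linearI) (simp_all add: vec_eq_iff algebra_simps)
  then show ?thesis by (simp add: linear_linear)
qed

lemma eigenvector_matrix_exp:
  fixes A :: "real^'n^'n"
  assumes "cmat A *v v = c *s v" shows "cmat (matrix_exp A) *v v = exp c *s v"
proof -
  have pow: "cmat (mpow A k) *v v = c ^ k *s v" for k
  proof (induction k)
    case (Suc k)
    have "cmat (mpow A (Suc k)) *v v = cmat A *v (cmat (mpow A k) *v v)"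
      by (simp add: cmat_mult matrix_vector_mul_assoc)
    also have "\<dots> = c ^ k *s (cmat A *v v)" by (simp only: Suc vector_scalar_commute)
    finally show ?case by (simp add: assms vector_smult_assoc mult.commute)
  qed (simp add: cmat_1)
  interpret L: bounded_linear "\<lambda>A :: real^'n^'n. cmat A *v v" by (rule bounded_linear_cmat)
  interpret S: bounded_linear "\<lambda>z :: complex. z *s v" by (rule bounded_linear_scalar_left)
  have "(\<lambda>k. cmat (mpow A k /\<^sub>R fact k) *v v) sums (cmat (matrix_exp A) *v v)"
    by (rule L.sums[OF matrix_exp_sums])
  then have "(\<lambda>k. (c ^ k /\<^sub>R fact k) *s v) sums (cmat (matrix_exp A) *v v)"
    by (simp only: L.scaleR S.scaleR pow)
  moreover have "(\<lambda>k. (c ^ k /\<^sub>R fact k) *s v) sums (exp c *s v)"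
    by (rule S.sums[OF exp_converges])
  ultimately show ?thesis by (rule sums_unique2)
qed

lemma norm_cmat_mult_le: "norm (cmat A *v v) \<le> onorm ((*v) A) * norm v" for A :: "real^'n^'n"
proof -
  have split: "(norm v)\<^sup>2 = (norm (\<chi> i. Re (v $ i)))\<^sup>2 + (norm (\<chi> i. Im (v $ i)))\<^sup>2" for v :: "complex^'n"
    by (simp add: norm_vec_def L2_set_def sum_nonneg cmod_power2 sum.distrib)
  have re: "(\<chi> i. Re ((cmat A *v v) $ i)) = A *v (\<chi> i. Re (v $ i))"
    and im: "(\<chi> i. Im ((cmat A *v v) $ i)) = A *v (\<chi> i. Im (v $ i))"
    by (simp_all add: matrix_vector_mult_def vec_eq_iff)
  let ?o = "onorm ((*v) A)"
  have "(norm (cmat A *v v))\<^sup>2 \<le> (?o * norm (\<chi> i. Re (v $ i)))\<^sup>2 + (?o * norm (\<chi> i. Im (v $ i)))\<^sup>2"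
    unfolding split[of "cmat A *v v"] re im
    by (intro add_mono power_mono norm_matrix_vector_mult_le_onorm norm_ge_zero)
  also have "\<dots> = (?o * norm v)\<^sup>2" by (simp add: power_mult_distrib split[of v] distrib_left)
  finally show ?thesis
    by (rule power2_le_imp_le) (simp add: onorm_pos_le)
qed

text \<open>
  On an eigenvector the matrix integral reduces to the scalar one, and along the segment from \<open>1\<close>
  to \<open>z\<close> the scalar integrand is the derivative of the principal branch.
\<close>

lemma eigenvector_integral_log:
  fixes X :: "real^'n^'n"
  assumes X: "X \<in> matrix_ball (mat 1) 1" and v: "v \<noteq> 0" "cmat X *v v = z *s v"
  shows "cmat (integral_log X) *v v = Ln z *s v" and "Re z > 0"
proof -
  define \<mu> where "\<mu> = z - 1"
  have mu: "cmat (X - mat 1) *v v = \<mu> *s v"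
  proof -
    have "cmat (X - mat 1) *v v = cmat X *v v - cmat (mat 1) *v v"
      by (rule linear_diff[OF bounded_linear.linear[OF bounded_linear_cmat]])
    then show ?thesis by (simp add: cmat_1 v \<mu>_def vec.scale_left_diff_distrib)
  qed
  have "norm \<mu> * norm v = norm (\<mu> *s v)" by (simp add: norm_vec_def norm_mult L2_set_right_distrib)
  also have "\<dots> \<le> onorm ((*v) (X - mat 1)) * norm v" by (metis mu norm_cmat_mult_le)
  finally have small: "norm \<mu> < 1" using v(1) X by (simp add: mem_matrix_ball_1)
  have re: "Re (1 + of_real s * \<mu>) > 0" if s: "s \<in> {0..1}" for s
  proof -
    have "- Re (of_real s * \<mu>) \<le> norm (of_real s * \<mu>)" using abs_Re_le_cmod[of "of_real s * \<mu>"] by linarith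
    also have "\<dots> \<le> norm \<mu>" using s mult_right_mono[of s 1 "norm \<mu>"] by (simp add: norm_mult)
    finally show ?thesis using small by simp
  qed
  show "Re z > 0" using re[of 1] by (simp add: \<mu>_def)
  have seg: "cmat (segment_to s X) *v v = (1 + of_real s * \<mu>) *s v" for s
  proof -
    interpret L: bounded_linear "\<lambda>A :: real^'n^'n. cmat A *v v" by (rule bounded_linear_cmat)
    show ?thesis unfolding segment_to_def
      by (simp only: L.add L.scaleR mu cmat_1)
        (simp add: vec_eq_iff scaleR_conv_of_real[where 'a=complex] algebra_simps)
  qed
  \<comment> \<open>\<open>v\<close> is an eigenvector of every matrix on the segment and therefore of the resolvents.\<close>
  have int: "cmat ((X - mat 1) ** resolvent s X) *v v = (\<mu> / (1 + of_real s * \<mu>)) *s v" if s: "s \<in> {0..1}" for s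
  proof -
    let ?z = "1 + of_real s * \<mu>"
    have z: "?z \<noteq> 0" using re[OF s] by (metis less_irrefl zero_complex.sel(1))
    have "resolvent s X ** segment_to s X = mat 1"
      unfolding resolvent_def by (rule matrix_inv_left_right[OF invertible_segment_to[OF X s]])
    then have "cmat (resolvent s X) *v (cmat (segment_to s X) *v v) = v"
      by (simp add: matrix_vector_mul_assoc cmat_1 flip: cmat_mult)
    then have "?z *s (cmat (resolvent s X) *v v) = v" by (simp only: seg vector_scalar_commute)
    then have "(1 / ?z * ?z) *s (cmat (resolvent s X) *v v) = (1 / ?z) *s v"
      by (simp only: vector_smult_assoc[symmetric])
    moreover have "1 / ?z * ?z = 1" using z by simp
    ultimately have r: "cmat (resolvent s X) *v v = (1 / ?z) *s v" by (simp only: vector_smult_lid)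
    have "cmat ((X - mat 1) ** resolvent s X) *v v = cmat (X - mat 1) *v (cmat (resolvent s X) *v v)"
      by (simp add: cmat_mult matrix_vector_mul_assoc)
    also have "\<dots> = (1 / ?z) *s (cmat (X - mat 1) *v v)" by (simp only: r vector_scalar_commute)
    finally show ?thesis by (simp only: mu vector_smult_assoc) simp
  qed
  have "((\<lambda>s. Ln (1 + of_real s * \<mu>)) has_vector_derivative \<mu> / (1 + of_real s * \<mu>)) (at s)" if s: "s \<in> {0..1}" for s
  proof -
    have "1 + of_real s * \<mu> \<notin> \<real>\<^sub>\<le>\<^sub>0" using re[OF s] by (auto simp: complex_nonpos_Reals_iff)
    moreover have "((\<lambda>s. 1 + of_real s * \<mu>) has_vector_derivative \<mu>) (at s)"
      by (auto intro!: derivative_eq_intros)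
    ultimately show ?thesis
      using field_vector_diff_chain_at[of "\<lambda>s. 1 + of_real s * \<mu>" \<mu> s Ln] has_field_derivative_Ln
      by (fastforce simp: o_def divide_inverse)
  qed
  from integral_0_1_eq_diff[OF this]
  have "((\<lambda>s. \<mu> / (1 + of_real s * \<mu>)) has_integral Ln z) {0..1}" by (simp add: \<mu>_def)
  from has_integral_linear[OF this bounded_linear_scalar_left[of v]]
  have "((\<lambda>s. (\<mu> / (1 + of_real s * \<mu>)) *s v) has_integral Ln z *s v) {0..1}" by (simp add: o_def)
  moreover have "((\<lambda>s. (\<mu> / (1 + of_real s * \<mu>)) *s v) has_integral cmat (integral_log X) *v v) {0..1}"
  proof (rule has_integral_eq)
    have "(\<lambda>s. (X - mat 1) ** resolvent s X) integrable_on {0..1}"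
      by (intro integrable_continuous_interval continuous_intros continuous_on_resolvent X)
    from has_integral_linear[OF integrable_integral[OF this] bounded_linear_cmat[of v]]
    show "((\<lambda>s. cmat ((X - mat 1) ** resolvent s X) *v v) has_integral cmat (integral_log X) *v v) {0..1}"
      by (simp add: o_def integral_log_def)
  qed (rule int)
  ultimately show "cmat (integral_log X) *v v = Ln z *s v" using has_integral_unique by blast
qed

text \<open>
  The eigenspace of \<open>log X\<close> for \<open>c\<close> is invariant under \<open>X\<close>, so it
  contains an eigenvector of \<open>X\<close>; this identifies \<open>c\<close> as the principal logarithm of
  a number with positive real part.
\<close>

lemma eigenvalues_integral_log:
  fixes X :: "real^'n^'n"
  assumes X: "X \<in> matrix_ball (mat 1) 1" and c: "c \<in> eigenvalues (integral_log X)"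
  shows "\<bar>Im c\<bar> < pi"
proof -
  obtain v where v: "v \<noteq> 0" "cmat (integral_log X) *v v = c *s v"
    using c by (auto simp: eigenvalues_def)
  let ?V = "{w. cmat (integral_log X) *v w = c *s w}"
  have comm: "cmat X ** cmat (integral_log X) = cmat (integral_log X) ** cmat X"
    using integral_log_commute[OF X refl] by (simp flip: cmat_mult)
  have "vec.subspace ?V"
    by (auto simp: vec.subspace_def matrix_vector_right_distrib vector_add_ldistrib
        vector_scalar_commute vector_smult_assoc mult.commute)
  moreover have "cmat X *v w \<in> ?V" if "w \<in> ?V" for w
  proof -
    have "cmat (integral_log X) *v (cmat X *v w) = cmat X *v (cmat (integral_log X) *v w)"
      by (simp add: matrix_vector_mul_assoc comm)
    then show ?thesis using that by (simp add: vector_scalar_commute)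
  qed
  moreover have "v \<in> ?V" using v by simp
  ultimately obtain z w where w: "w \<in> ?V" "w \<noteq> 0" "cmat X *v w = z *s w"
    using v(1) by (rule invariant_subspace_eigenvector)
  have "cmat (integral_log X) *v w = c *s w" using w(1) by blast
  with eigenvector_integral_log(1)[OF X w(2,3)] have "c *s w = Ln z *s w" by (simp only:)
  then have "c = Ln z \<or> w = 0" by (simp only: vec.scale_cancel_right)
  then have "c = Ln z" using w(2) by blast
  moreover have "\<bar>Im (Ln z)\<bar> < pi / 2"
    using eigenvector_integral_log(2)[OF X w(2,3)] Re_Ln_pos_lt[of z] by fastforce
  ultimately have "\<bar>Im c\<bar> < pi / 2" by simp
  then show ?thesis using pi_gt_zero by linarith
qed

text \<open>
  Any logarithm \<open>A\<close> commutes with \<open>X\<close>, hence with \<open>L = log X\<close>, so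
  \<open>D = A - L\<close> satisfies \<open>exp D = 1\<close>, that is \<open>D \<Phi> = 0\<close> with
  \<open>\<Phi> = \<integral>\<^sub>0\<^sup>1 exp (s D) ds\<close>. If \<open>\<Phi>\<close> were singular,
  its kernel would contain a common eigenvector of \<open>A\<close> and \<open>L\<close>. The two eigenvalues
  differ by a multiple of \<open>2 \<pi> i\<close> and both lie in the strip, hence agree. Then
  \<open>D\<close> kills this vector and \<open>\<Phi>\<close> fixes it, a contradiction.
\<close>

lemma matrix_log_unique:
  fixes A X :: "real^'n^'n"
  assumes X: "X \<in> matrix_ball (mat 1) 1" and A: "matrix_exp A = X"
    and strip: "\<And>c. c \<in> eigenvalues A \<Longrightarrow> \<bar>Im c\<bar> < pi"
  shows "A = integral_log X"
proof -
  let ?L = "integral_log X"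
  define D where "D = A - ?L"
  have AX: "A ** X = X ** A" using matrix_exp_commute[of A A] A by simp
  have AL: "A ** ?L = ?L ** A" by (rule integral_log_commute[OF X AX])
  have AD: "A ** D = D ** A" and LD: "?L ** D = D ** ?L"
    by (simp_all add: D_def AL matrix_mult.diff_left matrix_mult.diff_right)
  have expD: "matrix_exp D = mat 1"
  proof -
    have "matrix_exp (A + - ?L) = matrix_exp A ** matrix_exp (- ?L)"
      by (rule matrix_exp_add) (simp add: AL matrix_mult.minus_left matrix_mult.minus_right)
    then show ?thesis
      using matrix_exp_minus[of ?L] by (simp add: D_def A matrix_exp_integral_log[OF X])
  qed
  define \<Phi> where "\<Phi> = integral {0..1} (\<lambda>s. matrix_exp (s *\<^sub>R D))"
  have int: "(\<lambda>s. matrix_exp (s *\<^sub>R D)) integrable_on {0..1}"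
    by (intro integrable_continuous_interval continuous_intros)
  have "((\<lambda>s. D ** matrix_exp (s *\<^sub>R D)) has_integral (matrix_exp D - mat 1)) {0..1}"
    using integral_0_1_eq_diff[OF has_vector_derivative_matrix_exp_scaleR, of D] by simp
  then have D\<Phi>: "D ** \<Phi> = 0"
    using has_integral_linear[OF integrable_integral[OF int] matrix_mult.bounded_linear_right[of D]]
    by (auto simp: o_def \<Phi>_def expD dest: has_integral_unique)
  have comm: "V ** \<Phi> = \<Phi> ** V" if V: "V ** D = D ** V" for V
  proof -
    have "V ** matrix_exp (s *\<^sub>R D) = matrix_exp (s *\<^sub>R D) ** V" for s
      by (rule matrix_exp_commute) (simp add: V matrix_mult.scaleR_left matrix_mult.scaleR_right)
    then have "integral {0..1} (\<lambda>s. V ** matrix_exp (s *\<^sub>R D)) = integral {0..1} (\<lambda>s. matrix_exp (s *\<^sub>R D) ** V)"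
      by simp
    then show ?thesis
      using integral_linear[OF int matrix_mult.bounded_linear_right[of V]]
        integral_linear[OF int matrix_mult.bounded_linear_left[of V]] by (simp add: o_def \<Phi>_def)
  qed
  have "invertible \<Phi>"
  proof (rule ccontr)
    assume "\<not> invertible \<Phi>"
    then obtain u where u: "u \<noteq> 0" "\<Phi> *v u = 0" by (rule not_invertible_ker)
    define v :: "complex^'n" where "v = (\<chi> i. of_real (u $ i))"
    let ?V = "{w. cmat \<Phi> *v w = 0}"
    have "v \<noteq> 0" using u(1) by (auto simp: v_def vec_eq_iff)
    have "cmat \<Phi> *v v = (\<chi> i. of_real ((\<Phi> *v u) $ i))"
      by (simp add: v_def matrix_vector_mult_def vec_eq_iff)
    then have "v \<in> ?V" by (simp add: u(2) vec_eq_iff)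
    have "vec.subspace ?V"
      by (auto simp: vec.subspace_def matrix_vector_right_distrib vector_scalar_commute)
    moreover have "cmat M *v w \<in> ?V" if "M ** D = D ** M" "w \<in> ?V" for M w
    proof -
      have "cmat \<Phi> *v (cmat M *v w) = cmat M *v (cmat \<Phi> *v w)"
        by (simp add: matrix_vector_mul_assoc comm[OF that(1)] flip: cmat_mult)
      then show ?thesis using that(2) by simp
    qed
    ultimately obtain a b w where w: "w \<in> ?V" "w \<noteq> 0" "cmat A *v w = a *s w" "cmat ?L *v w = b *s w"
      using common_eigenvector[of ?V "cmat A" "cmat ?L" v] AD LD AL \<open>v \<in> ?V\<close> \<open>v \<noteq> 0\<close>
      by (metis (no_types, lifting) cmat_mult)
    have Dw: "cmat D *v w = (a - b) *s w"
      using linear_diff[OF bounded_linear.linear[OF bounded_linear_cmat], of A ?L w] w(3,4)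
      by (simp add: D_def vec.scale_left_diff_distrib)
    have "exp (a - b) *s w = 1 *s w"
      using eigenvector_matrix_exp[OF Dw] by (simp add: expD cmat_1)
    then have "exp (a - b) = 1 \<or> w = 0" by (simp only: vec.scale_cancel_right)
    then have "exp a = exp b" using w(2) by (simp add: exp_diff)
    then obtain n :: int where n: "a = b + complex_of_real (of_int (2 * n) * pi) * \<i>"
      unfolding exp_eq by auto
    have "\<bar>Im a\<bar> < pi" by (rule strip) (use w in \<open>auto simp: eigenvalues_def\<close>)
    moreover have "\<bar>Im b\<bar> < pi" 
      by (rule eigenvalues_integral_log[OF X]) (use w in \<open>auto simp: eigenvalues_def\<close>)
    ultimately have "\<bar>of_int (2 * n) * pi\<bar> < 2 * pi" using n by simp
    then have "\<bar>real_of_int n\<bar> < 1" using pi_gt_zero by (simp add: abs_mult)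
    then have "n = 0" by linarith
    then have "a = b" using n by simp
    then have "cmat (s *\<^sub>R D) *v w = 0 *s w" for s
      using linear_cmul[OF bounded_linear.linear[OF bounded_linear_cmat], of s D w] Dw by simp
    from eigenvector_matrix_exp[OF this] have "cmat (matrix_exp (s *\<^sub>R D)) *v w = w" for s by simp
    then have "cmat \<Phi> *v w = w"
      using integral_linear[OF int bounded_linear_cmat[of w]] by (simp add: o_def \<Phi>_def)
    then show False using w(1,2) by simp
  qed
  then have "D = D ** \<Phi> ** matrix_inv \<Phi>"
    by (simp add: matrix_inv_left_right flip: matrix_mul_assoc)
  then have "D = 0" by (simp add: D\<Phi> matrix_mult.zero_left)
  then show ?thesis by (simp add: D_def)
qed

lemma principal_log_eq:
  fixes X :: "real^'n^'n"
  assumes X: "X \<in> matrix_ball (mat 1) 1"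
  shows "principal_log X = integral_log X"
  unfolding principal_log_def
proof (rule the_equality)
  have "- pi < Im c \<and> Im c < pi" if "c \<in> eigenvalues (integral_log X)" for c
    using eigenvalues_integral_log[OF X that] by linarith
  then show "matrix_exp (integral_log X) = X \<and> (\<forall>c\<in>eigenvalues (integral_log X). - pi < Im c \<and> Im c < pi)"
    using matrix_exp_integral_log[OF X] by blast
  show "A = integral_log X" if "matrix_exp A = X \<and> (\<forall>c\<in>eigenvalues A. - pi < Im c \<and> Im c < pi)" for A
    by (rule matrix_log_unique[OF X]) (use that in \<open>auto simp: abs_less_iff\<close>)
qed


section \<open>The smooth correction term\<close>

text \<open>
  \<open>\<parallel>X - 1\<parallel> < 1\<close> gives
  \<open>|X x|\<^sup>2 \<le> 2 \<langle>x, X x\<rangle>\<close>, and \<open>|x| \<le> |Y| |X x|\<close>. Hence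
  \<open>x\<close> has a uniformly positive inner product with its image under every matrix on the segment
  from the identity to \<open>X\<close>. The bound degenerates only as \<open>X\<close> approaches the
  singular matrices.
\<close>

lemma norm_resolvent_mult_le:
  fixes X :: "real^'n^'n"
  assumes X: "X \<in> matrix_ball (mat 1) 1" and s: "s \<in> {0..1}" and Y: "Y ** X = mat 1"
  shows "norm (resolvent s X *v y) \<le> (1 + 2 * (norm Y)\<^sup>2) * norm y"
proof -
  define x where "x = resolvent s X *v y"
  let ?q = "(norm Y)\<^sup>2" and ?S = "segment_to s X"
  have y: "?S *v x = y"
    using matrix_inv_left_right(2)[OF invertible_segment_to[OF X s]]
    by (simp add: x_def resolvent_def matrix_vector_mul_assoc)
  have lower: "(norm x)\<^sup>2 \<le> ?q * (norm (X *v x))\<^sup>2"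
  proof -
    have "norm (Y *v (X *v x)) \<le> norm Y * norm (X *v x)" by (rule norm_matrix_vector_mult_le)
    then have "norm x \<le> norm Y * norm (X *v x)" by (simp add: matrix_vector_mul_assoc Y)
    from power_mono[OF this norm_ge_zero, of 2] show ?thesis by (simp add: power_mult_distrib)
  qed
  have accretive: "(norm (X *v x))\<^sup>2 \<le> 2 * (x \<bullet> (X *v x))"
  proof -
    have "norm ((X - mat 1) *v x) \<le> onorm ((*v) (X - mat 1)) * norm x"
      by (rule norm_matrix_vector_mult_le_onorm)
    also have "\<dots> \<le> 1 * norm x" using X by (intro mult_right_mono) (auto simp: mem_matrix_ball_1)
    finally have "(norm (X *v x - x))\<^sup>2 \<le> (norm x)\<^sup>2" by (simp add: matrix_vector_mult_diff_rdistrib)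
    then show ?thesis
      by (simp add: power2_norm_eq_inner inner_diff_left inner_diff_right inner_commute[of "X *v x" x])
  qed
  have "?S *v x = (1 - s) *\<^sub>R x + s *\<^sub>R (X *v x)"
    by (simp add: segment_to_def matrix_vector_mult_add_rdistrib matrix_vector_mult_diff_rdistrib
        algebra_simps flip: scaleR_matrix_vector_assoc)
  then have xy: "x \<bullet> y = (1 - s) * (norm x)\<^sup>2 + s * (x \<bullet> (X *v x))"
    by (simp flip: y add: inner_add_right power2_norm_eq_inner)
  have "(1 + 2 * ?q) * (x \<bullet> y) = (1 - s) * ((1 + 2 * ?q) * (norm x)\<^sup>2) + s * ((1 + 2 * ?q) * (x \<bullet> (X *v x)))"
    unfolding xy by (simp add: algebra_simps)
  also have "\<dots> \<ge> (1 - s) * (norm x)\<^sup>2 + s * (norm x)\<^sup>2"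
  proof (intro add_mono mult_left_mono)
    show "(norm x)\<^sup>2 \<le> (1 + 2 * ?q) * (norm x)\<^sup>2" by (simp add: distrib_right)
    have "0 \<le> x \<bullet> (X *v x)" using accretive zero_le_power2[of "norm (X *v x)"] by linarith
    moreover have "?q * (norm (X *v x))\<^sup>2 \<le> ?q * (2 * (x \<bullet> (X *v x)))"
      by (intro mult_left_mono accretive) simp
    ultimately show "(norm x)\<^sup>2 \<le> (1 + 2 * ?q) * (x \<bullet> (X *v x))"
      using lower by (simp add: distrib_right mult.assoc mult.left_commute)
  qed (use s in auto)
  finally have "(norm x)\<^sup>2 \<le> (1 + 2 * ?q) * (x \<bullet> y)" by (simp add: algebra_simps)
  also have "\<dots> \<le> (1 + 2 * ?q) * (norm x * norm y)"
    by (intro mult_left_mono norm_cauchy_schwarz) auto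
  finally have "norm x * norm x \<le> norm x * ((1 + 2 * ?q) * norm y)"
    by (simp add: power2_eq_square mult_ac)
  then have "norm x \<le> (1 + 2 * ?q) * norm y"
    by (cases "norm x = 0") (auto simp: mult_le_cancel_left)
  then show ?thesis by (simp add: x_def)
qed

text \<open>
  Expressed through \<open>exp (- A)\<close>, which is the inverse of \<open>X\<close> when
  \<open>A = log X\<close>, the bound for the resolvents becomes a smooth function defined for every matrix
  \<open>A\<close>.
\<close>

definition resolvent_bound :: "real^'n^'n \<Rightarrow> real" where
  "resolvent_bound A = (real CARD('n) * real CARD('n) * (1 + 2 * (matrix_exp (- A) \<bullet> matrix_exp (- A)))) ^ 2"

lemma norm_matrix_le_component: 
  fixes A :: "real^'n^'n"
  assumes "\<And>i j. \<bar>A $ i $ j\<bar> \<le> B" shows "norm A \<le> real CARD('n) * real CARD('n) * B"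
proof -
  have "norm A \<le> (\<Sum>i\<in>UNIV. norm (A $ i))" unfolding norm_vec_def[of A] by (rule L2_set_le_sum) simp
  also have "\<dots> \<le> (\<Sum>i\<in>(UNIV :: 'n set). \<Sum>j\<in>(UNIV :: 'n set). B)"
    by (intro sum_mono order_trans[OF norm_le_l1_cart]) (simp add: assms sum_mono)
  finally show ?thesis by simp
qed

lemma norm_resolvent_le:
  fixes X :: "real^'n^'n"
  assumes X: "X \<in> matrix_ball (mat 1) 1" and s: "s \<in> {0..1}"
  shows "(norm (resolvent s X))\<^sup>2 \<le> resolvent_bound (integral_log X)"
proof -
  let ?Y = "matrix_exp (- integral_log X)"
  have "?Y ** X = mat 1" using matrix_exp_minus'[of "integral_log X"] by (simp add: matrix_exp_integral_log[OF X])
  then have "onorm ((*v) (resolvent s X)) \<le> 1 + 2 * (norm ?Y)\<^sup>2"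
    by (intro onorm_le norm_resolvent_mult_le X s)
  then have "\<bar>resolvent s X $ i $ j\<bar> \<le> 1 + 2 * (norm ?Y)\<^sup>2" for i j
    using matrix_component_le_onorm order_trans by blast
  from power_mono[OF norm_matrix_le_component[OF this] norm_ge_zero, of 2]
  show ?thesis by (simp add: resolvent_bound_def power2_norm_eq_inner)
qed

lemma Ck_on_resolvent_bound: "Ck_on UNIV k (resolvent_bound :: real^'n^'n \<Rightarrow> _)"
proof -
  have "Ck_on UNIV k (\<lambda>A :: real^'n^'n. matrix_exp (- A))"
    by (rule Ck_on_compose[OF _ _ _ Ck_on_bounded_linear[OF open_UNIV bounded_linear_minus[OF bounded_linear_ident]]
          Ck_on_matrix_exp]) auto
  then show ?thesis
    unfolding resolvent_bound_def[abs_def] power2_eq_square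
    by (intro Ck_on_bilinear[OF open_UNIV bounded_bilinear_mult] Ck_on_bilinear[OF open_UNIV bounded_bilinear_inner]
        Ck_on_add Ck_on_const open_UNIV)
qed

definition cut_resolvent :: "real \<Rightarrow> real^'n^'n \<Rightarrow> real^'n^'n" where
  "cut_resolvent s A = truncated_inv (segment_to s (matrix_exp A), resolvent_bound A)"

text \<open>
  For \<open>X\<close> in the ball and \<open>A = log X\<close> the integrand is
  \<open>R V X R - V R X R\<close>, whose integral is the derivative of the logarithm in the direction
  \<open>V X\<close>, minus \<open>V\<close>. Writing the subtracted term \<open>V\<close> as an integral as
  well makes the integrand vanish for all commuting pairs, also where the resolvent has been truncated.
\<close>

definition correction :: "(real^'n^'n) \<times> (real^'n^'n) \<Rightarrow> real^'n^'n" where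
  "correction p = integral {0..1} (\<lambda>s.
     (cut_resolvent s (fst p) ** snd p - snd p ** cut_resolvent s (fst p)) ** matrix_exp (fst p) ** cut_resolvent s (fst p))"

lemma smooth_on_correction: "smooth_on UNIV (correction :: (real^'n^'n) \<times> (real^'n^'n) \<Rightarrow> _)"
proof -
  have "Ck_on UNIV k (correction :: (real^'n^'n) \<times> (real^'n^'n) \<Rightarrow> _)" for k
  proof -
    have 1: "Ck_on UNIV k (\<lambda>p :: real \<times> (real^'n^'n) \<times> (real^'n^'n). fst (snd p))"
      and 2: "Ck_on UNIV k (\<lambda>p :: real \<times> (real^'n^'n) \<times> (real^'n^'n). snd (snd p))"
      by (rule Ck_on_linear_comp[OF open_UNIV bounded_linear_fst Ck_on_snd[OF open_UNIV]]
          Ck_on_linear_comp[OF open_UNIV bounded_linear_snd Ck_on_snd[OF open_UNIV]])+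
    have E: "Ck_on UNIV k (\<lambda>p :: real \<times> (real^'n^'n) \<times> (real^'n^'n). matrix_exp (fst (snd p)))"
      by (rule Ck_on_compose[OF _ _ _ 1 Ck_on_matrix_exp]) auto
    have q: "Ck_on UNIV k (\<lambda>p :: real \<times> (real^'n^'n) \<times> (real^'n^'n). resolvent_bound (fst (snd p)))"
      by (rule Ck_on_compose[OF _ _ _ 1 Ck_on_resolvent_bound]) auto
    have S: "Ck_on UNIV k (\<lambda>p :: real \<times> (real^'n^'n) \<times> (real^'n^'n). segment_to (fst p) (matrix_exp (fst (snd p))))"
      using Ck_on_compose[OF _ _ _ Ck_on_Pair[OF open_UNIV Ck_on_fst[OF open_UNIV] E] Ck_on_segment_to[OF open_UNIV]]
      by simp
    have R: "Ck_on UNIV k (\<lambda>p :: real \<times> (real^'n^'n) \<times> (real^'n^'n). cut_resolvent (fst p) (fst (snd p)))"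
      unfolding cut_resolvent_def
      by (rule Ck_on_compose[OF _ _ _ Ck_on_Pair[OF open_UNIV S q] Ck_on_truncated_inv]) auto
    have "Ck_on UNIV k (\<lambda>p :: real \<times> (real^'n^'n) \<times> (real^'n^'n).
       (cut_resolvent (fst p) (fst (snd p)) ** snd (snd p) - snd (snd p) ** cut_resolvent (fst p) (fst (snd p)))
         ** matrix_exp (fst (snd p)) ** cut_resolvent (fst p) (fst (snd p)))"
      by (intro Ck_on_matrix_mult Ck_on_diff R E 2 open_UNIV)
    from Ck_on_integral_param[OF open_UNIV open_UNIV _ this]
    show ?thesis by (simp add: correction_def[abs_def])
  qed
  then show ?thesis by (simp add: smooth_on_def)
qed

lemma correction_eq_0:
  fixes A V :: "real^'n^'n"
  assumes "A ** V = V ** A" shows "correction (A, V) = 0"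
proof -
  have "V ** cut_resolvent s A = cut_resolvent s A ** V" for s
    unfolding cut_resolvent_def
    by (intro truncated_inv_commute segment_to_commute matrix_exp_commute) (simp add: assms)
  then show ?thesis by (simp add: correction_def matrix_mult.zero_left)
qed

lemma correction_integral_log:
  fixes X V :: "real^'n^'n"
  assumes X: "X \<in> matrix_ball (mat 1) 1"
  shows "integral {0..1} (\<lambda>s. resolvent s X ** (V ** X) ** resolvent s X) = V + correction (integral_log X, V)"
proof -
  have "((\<lambda>s. resolvent s X ** (V ** X) ** resolvent s X - V ** (resolvent s X ** X ** resolvent s X)) has_integral
     (integral {0..1} (\<lambda>s. resolvent s X ** (V ** X) ** resolvent s X) - V ** mat 1)) {0..1}"
  proof (rule has_integral_diff)
    show "((\<lambda>s. resolvent s X ** (V ** X) ** resolvent s X) has_integral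
        integral {0..1} (\<lambda>s. resolvent s X ** (V ** X) ** resolvent s X)) {0..1}"
      by (intro integrable_integral integrable_continuous_interval continuous_intros continuous_on_resolvent X)
    show "((\<lambda>s. V ** (resolvent s X ** X ** resolvent s X)) has_integral V ** mat 1) {0..1}"
      using has_integral_linear[OF has_integral_resolvent_self[OF X] matrix_mult.bounded_linear_right]
      by (simp add: o_def)
  qed
  moreover have "integral {0..1} (\<lambda>s. resolvent s X ** (V ** X) ** resolvent s X - V ** (resolvent s X ** X ** resolvent s X))
     = correction (integral_log X, V)"
    unfolding correction_def
  proof (rule integral_cong)
    fix s :: real assume s: "s \<in> {0..1}"
    have c: "cut_resolvent s (integral_log X) = resolvent s X"
      using truncated_inv_eq[OF invertible_segment_to[OF X s]] norm_resolvent_le[OF X s]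
      by (simp add: cut_resolvent_def matrix_exp_integral_log[OF X] resolvent_def)
    show "resolvent s X ** (V ** X) ** resolvent s X - V ** (resolvent s X ** X ** resolvent s X) =
      (cut_resolvent s (fst (integral_log X, V)) ** snd (integral_log X, V) -
        snd (integral_log X, V) ** cut_resolvent s (fst (integral_log X, V))) **
        matrix_exp (fst (integral_log X, V)) ** cut_resolvent s (fst (integral_log X, V))"
      by (simp add: c matrix_exp_integral_log[OF X] matrix_mult.diff_left matrix_mul_assoc)
  qed
  ultimately have "correction (integral_log X, V)
      = integral {0..1} (\<lambda>s. resolvent s X ** (V ** X) ** resolvent s X) - V"
    by (simp add: integral_unique)
  then show ?thesis by (simp add: algebra_simps)
qed

section \<open>Equivalence of the two systems\<close>

lemma has_derivative_principal_log:
  fixes X :: "real^'n^'n"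
  assumes X: "X \<in> matrix_ball (mat 1) 1"
  shows "(principal_log has_derivative
    (\<lambda>H. integral {0..1} (\<lambda>s. resolvent s X ** H ** resolvent s X))) (at X)"
  by (rule has_derivative_transform_within_open[OF has_derivative_integral_log[OF X] open_matrix_ball X])
    (simp add: principal_log_eq)

lemma matrix_exp_principal_log: "X \<in> matrix_ball (mat 1) 1 \<Longrightarrow> matrix_exp (principal_log X) = X"
  by (simp add: principal_log_eq matrix_exp_integral_log)

lemma principal_log_derivative_group_field:
  fixes X V :: "real^'n^'n"
  assumes X: "X \<in> matrix_ball (mat 1) 1"
  shows "integral {0..1} (\<lambda>s. resolvent s X ** (V ** X - c *\<^sub>R (X ** principal_log X)) ** resolvent s X)
    = V - c *\<^sub>R principal_log X + correction (principal_log X, V)"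
proof -
  let ?D = "\<lambda>H. integral {0..1} (\<lambda>s. resolvent s X ** H ** resolvent s X)"
  have lin: "linear ?D" by (rule has_derivative_linear[OF has_derivative_integral_log[OF X]])
  have comm: "integral_log X ** X = X ** integral_log X" by (rule integral_log_commute[OF X refl, symmetric])
  have "?D (X ** integral_log X) = integral_log X"
    using integral_log_derivative_commuting[OF X comm] by (simp add: integral_unique comm)
  then show ?thesis
    using linear_diff[OF lin, of "V ** X" "c *\<^sub>R (X ** integral_log X)"]
      linear_cmul[OF lin, of c "X ** integral_log X"] correction_integral_log[OF X, of V]
    by (simp add: principal_log_eq[OF X])
qed

lemma diffeomorphism_principal_log:
  "diffeomorphism_onto_image (matrix_ball (mat 1) 1) (principal_log :: real^'n^'n \<Rightarrow> _)"
proof -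
  let ?B = "matrix_ball (mat 1) 1 :: (real^'n^'n) set"
  have inj: "inj_on principal_log ?B" by (rule inj_on_inverseI[of _ matrix_exp]) (rule matrix_exp_principal_log)
  have smooth: "Ck_on ?B k principal_log" for k
    by (rule Ck_on_cong[OF open_matrix_ball _ Ck_on_integral_log]) (simp add: principal_log_eq)
  have op: "open (principal_log ` ?B)"
    using smooth[of 0] by (intro invariance_of_domain open_matrix_ball inj) simp
  have "Ck_on (principal_log ` ?B) k (inv_into ?B principal_log)" for k
    by (rule Ck_on_cong[OF op _ Ck_on_subset[OF Ck_on_matrix_exp subset_UNIV]])
      (auto simp: inv_into_f_f[OF inj] matrix_exp_principal_log)
  then show ?thesis
    using inj smooth op open_matrix_ball by (auto simp: diffeomorphism_onto_image_def smooth_on_def)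
qed

text \<open>
  The derivative of the logarithm maps one right-hand side to the other. For the converse the curve is
  recovered as the exponential of its logarithm, and the derivative of the exponential inverts that of the
  logarithm.
\<close>

lemma principal_log_curve_iff:
  fixes x :: "real \<Rightarrow> real^'n^'n"
  assumes J: "open J" "t \<in> J" and x: "\<And>s. s \<in> J \<Longrightarrow> x s \<in> matrix_ball (mat 1) 1"
  shows "(x has_vector_derivative (V ** x t - c *\<^sub>R (x t ** principal_log (x t)))) (at t) \<longleftrightarrow>
    ((\<lambda>s. principal_log (x s)) has_vector_derivative
       (V - c *\<^sub>R principal_log (x t) + correction (principal_log (x t), V))) (at t)"
    (is "(x has_vector_derivative ?F) _ \<longleftrightarrow> (_ has_vector_derivative ?G) _")
proof
  note X = x[OF J(2)]
  let ?D = "\<lambda>H. integral {0..1} (\<lambda>s. resolvent s (x t) ** H ** resolvent s (x t))"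
  have DF: "?D ?F = ?G" by (rule principal_log_derivative_group_field[OF X])
  show "((\<lambda>s. principal_log (x s)) has_vector_derivative ?G) (at t)" if "(x has_vector_derivative ?F) (at t)"
    using has_vector_derivative_compose[OF that has_derivative_principal_log[OF X]] DF by simp
  assume e: "((\<lambda>s. principal_log (x s)) has_vector_derivative ?G) (at t)"
  let ?E = "frechet_derivative matrix_exp (at (principal_log (x t)))"
  have E: "(matrix_exp has_derivative ?E) (at (principal_log (x t)))"
    by (rule Ck_on_SucD[OF Ck_on_matrix_exp UNIV_I])
  have "((\<lambda>Y. matrix_exp (principal_log Y)) has_derivative (\<lambda>H. ?E (?D H))) (at (x t))"
    by (rule has_derivative_compose[OF has_derivative_principal_log[OF X] E])
  then have "((\<lambda>Y. Y) has_derivative (\<lambda>H. ?E (?D H))) (at (x t))"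
    by (rule has_derivative_transform_within_open[OF _ open_matrix_ball X]) (simp add: matrix_exp_principal_log)
  from has_derivative_unique[OF this has_derivative_ident]
  have "?E (?D ?F) = ?F" by (rule fun_cong)
  then have "((\<lambda>s. matrix_exp (principal_log (x s))) has_vector_derivative ?F) (at t)"
    using has_vector_derivative_compose[OF e E] by (simp only: DF)
  then show "(x has_vector_derivative ?F) (at t)"
    by (rule has_vector_derivative_transform_within_open[OF _ J]) (simp add: matrix_exp_principal_log x)
qed

theorem mainTheorem5:
  fixes d :: nat and a :: "nat \<Rightarrow> real"
  assumes "d \<ge> 2"
    and "Hurwitz (monom 1 d + (\<Sum>i<d. monom (a i) i))"
  shows "\<exists>K :: (real^'n^'n) \<times> (real^'n^'n) \<Rightarrow> real^'n^'n.
           smooth_on UNIV K \<and>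
           (\<forall>e1 e2. e1 ** e2 - e2 ** e1 = 0 \<longrightarrow> K (e1, e2) = 0) \<and>
           differentially_equivalent d (matrix_ball (mat 1) 1) principal_log
             (group_system d a) (log_system d a K)"
proof (intro exI[of _ correction] conjI allI impI)
  show "smooth_on UNIV (correction :: (real^'n^'n) \<times> (real^'n^'n) \<Rightarrow> _)" by (rule smooth_on_correction)
  show "correction (e1, e2) = 0" if "e1 ** e2 - e2 ** e1 = 0" for e1 e2 :: "real^'n^'n"
    using that by (intro correction_eq_0) simp
  show "differentially_equivalent d (matrix_ball (mat 1) 1) principal_log
     (group_system d a) (log_system d a (correction :: (real^'n^'n) \<times> (real^'n^'n) \<Rightarrow> _))"
    unfolding differentially_equivalent_def
  proof (intro conjI allI impI diffeomorphism_principal_log)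
    fix J :: "real set" and x :: "real \<Rightarrow> nat \<Rightarrow> real^'n^'n"
    assume J: "open J \<and> is_interval J \<and> (\<forall>t\<in>J. x t 1 \<in> matrix_ball (mat 1) 1)"
    let ?y = "\<lambda>t. (x t)(1 := principal_log (x t 1))"
    have "((\<lambda>s. x s i) has_vector_derivative group_system d a (x t) i) (at t) \<longleftrightarrow>
      ((\<lambda>s. ?y s i) has_vector_derivative log_system d a correction (?y t) i) (at t)"
      if t: "t \<in> J" and i: "i \<in> {1..d}" for t i
    proof (cases "i = 1")
      case True
      then show ?thesis
        using principal_log_curve_iff[OF _ t, of "\<lambda>s. x s 1" "x t 2" "a (d - 1)"] J
        by (simp add: group_system_def log_system_def)
    next
      case False
      then show ?thesis using i by (simp add: group_system_def log_system_def)
    qed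
    then show "solves_ode d (group_system d a) J x \<longleftrightarrow> solves_ode d (log_system d a correction) J ?y"
      by (simp add: solves_ode_def)
  qed
qed

end
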